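(* Let $k$ be a field of characteristic zero and let $f(z), g(z) \in k[z]$ be polynomials in one variable $z$, of degrees $m = \deg f(z)$ and $n = \deg g(z)$ respectively. (It is not assumed that $z$ is a faithful parameter of the plane curve parametrized by $(f(z), g(z))$.) Assume that there is an integer $c > 0$ with $c \le \min(m,n)$ and that there are polynomials $u(z), v(z)$ in the polynomial ring $k[f(z),g(z)]$ such that $\deg u(z) = m - c$ and $\deg v(z) = n - c$. Then either $m$ divides $n$ or $n$ divides $m$.
   Context: $k[f(z),g(z)]$ denotes the $k$-subalgebra of $k[z]$ generated by $f(z)$ and $g(z)$. The parameter $z$ is called faithful if $k(f(z),g(z)) = k(z)$; the theorem allows $z$ to be unfaithful. *)

theory Defs
  imports "HOL-Computational_Algebra.Polynomial"
begin

text \<open>Closure under subtraction follows from closure under scaling by \<open>-1\<close>.\<close>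

definition is_subalgebra :: "'a::comm_ring_1 poly set \<Rightarrow> bool" where
  "is_subalgebra A \<longleftrightarrow>
     1 \<in> A \<and>
     (\<forall>p\<in>A. \<forall>q\<in>A. p + q \<in> A) \<and>
     (\<forall>p\<in>A. \<forall>q\<in>A. p * q \<in> A) \<and>
     (\<forall>a. \<forall>p\<in>A. smult a p \<in> A)"

definition subalgebra_gen :: "'a::comm_ring_1 poly set \<Rightarrow> 'a poly set" where
  "subalgebra_gen S = is_subalgebra hull S"

end

theory Submission
  imports Defs "Jordan_Normal_Form.Char_Poly" "HOL-Computational_Algebra.Formal_Laurent_Series"
    "HOL-Computational_Algebra.Polynomial_Factorial"
begin

text \<open>
  By symmetry let \<open>m > n\<close>, and suppose that \<open>n\<close> does not divide \<open>m\<close>. Put \<open>x = f(z)\<close> and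
  \<open>y = g(z)\<close>. The degree in \<open>z\<close> extends to the field of Laurent series in \<open>1/z\<close>, and on the
  subfield \<open>K = k(x)\<close> it takes values divisible by \<open>m\<close>. Let \<open>P\<close> be the minimal polynomial of
  \<open>y\<close> over \<open>K\<close> and \<open>N\<close> its degree; \<open>P\<close> has coefficients in \<open>k[x]\<close>.

  Call a monic polynomial \<open>h\<close> over \<open>K\<close> of degree \<open>s\<close> optimal if the degree of \<open>h(y)\<close> is not
  congruent modulo \<open>m\<close> to the degree of any \<open>q(y)\<close> with \<open>q\<close> nonzero over \<open>K\<close> of degree below \<open>s\<close>.
  There is one for each \<open>s < N\<close>, by Gaussian elimination on coordinates with respect to
  \<open>1, z, \<dots>, z^(m-1)\<close> (\<open>elimination\<close>); let \<open>e s\<close> be the degree of its value. If optimal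
  polynomials can be chosen with coefficients in \<open>k[x]\<close>, they form a basis of \<open>k[f,g]\<close> over
  \<open>k[x]\<close> in which no cancellation of leading terms happens, so that the degrees of
  elements of \<open>k[f,g]\<close> are exactly the numbers \<open>e s + m a\<close> with \<open>s < N\<close> and \<open>a \<ge> 0\<close>
  (\<open>value_via_basis\<close>).

  The numbers \<open>e s\<close> are built up in levels. Starting from \<open>r = 1\<close>, let the values of
  polynomials of degree below \<open>r\<close> fill a group \<open>d\<int>\<close>; an optimal \<open>Q\<close> of degree \<open>r\<close> has a value
  \<open>\<delta>\<close> outside this group, and with \<open>n' = d / gcd d \<delta>\<close> the products \<open>Q^j h\<close>, \<open>j < n'\<close>, are optimal
  whenever \<open>h\<close> is, up to the next level \<open>r n'\<close> (\<open>level_step\<close>, \<open>opt_mult_power\<close>). The first step has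
  \<open>Q = y\<close>, so with \<open>b = m / gcd m n\<close> one gets \<open>e (s + 1) = e s + n\<close> unless \<open>b\<close> divides \<open>s + 1\<close>.

  The theorem follows (\<open>no_common_shift\<close>). Let \<open>m - c = e s + m a\<close> and \<open>n - c = e t + m a'\<close>. If
  \<open>b\<close> does not divide \<open>s + 1\<close>, then \<open>e (s + 1) = e s + n\<close> is congruent to \<open>e t\<close>, hence
  \<open>t = s + 1\<close> and \<open>n - c \<ge> e t \<ge> n\<close>, which is absurd. Otherwise
  \<open>e s \<ge> (b - 1) n = lcm m n - n \<ge> 2 m - n > m\<close>, which is absurd too.

  Characteristic zero enters in the choice of optimal polynomials over \<open>k[x]\<close>. At a level
  \<open>r < N\<close> with \<open>N = D r\<close>, the approximate \<open>D\<close>-th root of \<open>P\<close>, that is the monic \<open>H\<close> of degree \<open>r\<close> for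
  which \<open>P - H^D\<close> has degree below \<open>N - r\<close>, has coefficients in \<open>k[x]\<close>; computing it requires
  division by \<open>D\<close>. It is optimal: expand \<open>P\<close> in powers of an optimal \<open>Q\<close> over \<open>K\<close>, and let \<open>a\<close> be the
  coefficient of \<open>Q^(D-1)\<close>; the Tschirnhausen substitution \<open>Q + a/D\<close> moves \<open>Q\<close> towards \<open>H\<close>, and it
  stays optimal because the degree of \<open>a(y)\<close> is at most \<open>\<delta>\<close>
  (\<open>approximate_root_closer\<close>). That bound is \<open>slope_bound\<close>. It reflects that the curve
  has only one place at infinity, and it rests on the integrality of elements of degree zero
  over the valuation ring of \<open>K\<close> (\<open>unit_integral\<close>).
\<close>

section \<open>Polynomials with coefficients in a subring\<close>

definition is_subring :: "'l::comm_ring_1 set \<Rightarrow> bool" where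
  "is_subring S \<longleftrightarrow> 1 \<in> S \<and> (\<forall>a\<in>S. \<forall>b\<in>S. a - b \<in> S) \<and> (\<forall>a\<in>S. \<forall>b\<in>S. a * b \<in> S)"

definition over :: "'l::comm_ring_1 set \<Rightarrow> 'l poly \<Rightarrow> bool" where
  "over S p \<longleftrightarrow> (\<forall>i. coeff p i \<in> S)"

lemma subring_closed:
  assumes "is_subring S"
  shows "0 \<in> S" "1 \<in> S" "a \<in> S \<Longrightarrow> b \<in> S \<Longrightarrow> a - b \<in> S" "a \<in> S \<Longrightarrow> b \<in> S \<Longrightarrow> a + b \<in> S"
    "a \<in> S \<Longrightarrow> - a \<in> S" "a \<in> S \<Longrightarrow> b \<in> S \<Longrightarrow> a * b \<in> S"
proof -
  show 0: "0 \<in> S" and "1 \<in> S" and d: "\<And>a b. a \<in> S \<Longrightarrow> b \<in> S \<Longrightarrow> a - b \<in> S"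
    and "a \<in> S \<Longrightarrow> b \<in> S \<Longrightarrow> a * b \<in> S"
    using assms unfolding is_subring_def by (metis diff_self)+
  show m: "\<And>a. a \<in> S \<Longrightarrow> - a \<in> S"
    using d[OF 0] by (metis diff_0)
  show "a \<in> S \<Longrightarrow> b \<in> S \<Longrightarrow> a + b \<in> S"
    using d m by (metis diff_minus_eq_add)
qed

lemma subring_sum:
  assumes "is_subring S" "\<And>i. i \<in> I \<Longrightarrow> f i \<in> S"
  shows "sum f I \<in> S"
  using assms(2) by (induction I rule: infinite_finite_induct) (auto intro: subring_closed[OF assms(1)])

lemma subring_prod:
  assumes "is_subring S" "\<And>i. i \<in> I \<Longrightarrow> f i \<in> S"
  shows "prod f I \<in> S"
  using assms(2) by (induction I rule: infinite_finite_induct) (auto intro: subring_closed[OF assms(1)])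

lemma subring_power:
  assumes "is_subring S" "a \<in> S"
  shows "a ^ n \<in> S"
  using assms(2) by (induction n) (auto intro: subring_closed[OF assms(1)])

lemma subring_of_nat:
  assumes "is_subring S"
  shows "of_nat n \<in> S"
  by (induction n) (auto intro: subring_closed[OF assms(1)])

lemma over_mono: "over S p \<Longrightarrow> S \<subseteq> T \<Longrightarrow> over T p"
  by (auto simp: over_def)

lemma over_pCons: "over S (pCons c p) \<longleftrightarrow> c \<in> S \<and> over S p"
  unfolding over_def by (metis coeff_pCons_0 coeff_pCons_Suc not0_implies_Suc)

lemma over_monom: "is_subring S \<Longrightarrow> c \<in> S \<Longrightarrow> over S (monom c n)"
  by (auto simp: over_def subring_closed)

lemma is_subring_over:
  assumes S: "is_subring S"
  shows "is_subring (Collect (over S))"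
  unfolding is_subring_def
  by (auto simp: over_def coeff_mult intro!: subring_closed[OF S] subring_sum[OF S])

lemmas over_closed = subring_closed[OF is_subring_over, unfolded mem_Collect_eq]
lemmas over_sum = subring_sum[OF is_subring_over, unfolded mem_Collect_eq]
lemmas over_prod = subring_prod[OF is_subring_over, unfolded mem_Collect_eq]
lemmas over_power = subring_power[OF is_subring_over, unfolded mem_Collect_eq]

lemma poly_over_mem:
  assumes S: "is_subring S" and "over S p" "x \<in> S"
  shows "poly p x \<in> S"
  using assms(2,3) unfolding poly_altdef over_def
  by (intro subring_sum[OF S] subring_closed(6)[OF S] subring_power[OF S]) auto

text \<open>Division by a monic polynomial involves no division of coefficients, so it stays inside the subring.\<close>

lemma over_divmod:
  fixes p q :: "'l::field poly"
  assumes S: "is_subring S" and q: "over S q" "lead_coeff q = 1" and p: "over S p"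
  shows "over S (p div q) \<and> over S (p mod q)"
  using p
proof (induction "degree p" arbitrary: p rule: less_induct)
  case less
  show ?case
  proof (cases "degree p < degree q")
    case True
    then show ?thesis using less.prems by (auto simp: div_poly_less mod_poly_less over_closed[OF S])
  next
    case ge: False
    show ?thesis
    proof (cases "degree q = 0")
      case True
      then have "q = 1" using q(2) by (auto elim!: degree_eq_zeroE simp: one_pCons)
      then show ?thesis using less.prems by (auto simp: over_closed[OF S])
    next
      case dq: False
      define t where "t = monom (lead_coeff p) (degree p - degree q)"
      define p' where "p' = p - t * q"
      have t: "over S t" unfolding t_def using less.prems by (intro over_monom[OF S]) (simp add: over_def)
      have p': "over S p'" unfolding p'_def using t less.prems q(1) by (intro over_closed[OF S])
      have "degree p' < degree p"
      proof -
        have p0: "lead_coeff p \<noteq> 0" using ge dq by auto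
        have dt: "degree (t * q) = degree p"
          using p0 q(2) ge dq unfolding t_def by (subst degree_mult_eq) (auto simp: degree_monom_eq)
        have "lead_coeff (t * q) = lead_coeff p"
          by (subst lead_coeff_mult) (use p0 q(2) in \<open>simp add: t_def degree_monom_eq\<close>)
        then have "coeff p k = coeff (t * q) k" if "degree p \<le> k" for k
          using that dt by (cases "k = degree p") (auto simp: coeff_eq_0)
        then show ?thesis unfolding p'_def using dt ge dq by (intro degree_lessI) auto
      qed
      from less.hyps[OF this p'] have "over S (p' div q) \<and> over S (p' mod q)" .
      moreover have "p = p' + t * q" by (simp add: p'_def)
      moreover have "q \<noteq> 0" using q(2) by auto
      ultimately show ?thesis using t by (auto simp: over_closed[OF S])
    qed
  qed
qed

section \<open>Integrality over a subring\<close>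

text \<open>The determinant trick: multiplication by \<open>t\<close> acts on the span of the \<open>b i\<close> through the matrix \<open>a\<close>,
  which makes \<open>(b i)\<close> an eigenvector for the eigenvalue \<open>t\<close>; the characteristic polynomial is monic and its
  coefficients are polynomial expressions in the entries.\<close>

lemma integral_of_stable_span:
  fixes a :: "nat \<Rightarrow> nat \<Rightarrow> 'l::field"
  assumes S: "is_subring S" and a: "\<And>i j. i < n \<Longrightarrow> j < n \<Longrightarrow> a i j \<in> S"
    and stable: "\<And>i. i < n \<Longrightarrow> t * b i = (\<Sum>j<n. a i j * b j)"
    and nz: "i0 < n" "b i0 \<noteq> 0"
  obtains C where "over S C" "lead_coeff C = 1" "poly C t = 0"
proof -
  define A where "A = mat n n (\<lambda>(i,j). a i j)"
  have A: "A \<in> carrier_mat n n" by (simp add: A_def)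
  have "A *\<^sub>v vec n b = t \<cdot>\<^sub>v vec n b"
    using stable by (intro eq_vecI) (auto simp: A_def scalar_prod_def lessThan_atLeast0)
  moreover have "vec n b \<noteq> 0\<^sub>v n"
    using nz by (metis index_vec index_zero_vec(1))
  ultimately have "eigenvalue A t"
    unfolding eigenvalue_def eigenvector_def using A by (intro exI[of _ "vec n b"]) auto
  then have "poly (char_poly A) t = 0" using eigenvalue_root_char_poly[OF A] by simp
  moreover have "lead_coeff (char_poly A) = 1" using degree_monic_char_poly[OF A] by simp
  moreover have "over S (char_poly A)"
  proof -
    have "over S (index_mat (char_poly_matrix A) (i, j))" if "i < n" "j < n" for i j
      using that a by (auto simp: char_poly_matrix_def A_def over_pCons over_closed[OF S] subring_closed[OF S])
    moreover have "char_poly_matrix A \<in> carrier_mat n n" using A by simp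
    moreover have "over S (signof p)" for p :: "nat \<Rightarrow> nat"
      by (auto simp: sign_def over_closed[OF S])
    ultimately show ?thesis unfolding char_poly_def
      by (subst det_def')
        (auto intro!: over_sum[OF S] over_closed[OF S] over_prod[OF S] simp: permutes_in_image[of _ "{0..<n}", simplified])
  qed
  ultimately show thesis using that by blast
qed

section \<open>Expansions in powers of a monic polynomial\<close>

lemma degree_div_cases:
  fixes Q :: "'l::field poly"
  assumes "degree Q > 0"
  shows "h div Q = 0 \<or> degree h = degree (h div Q) + degree Q"
proof (cases "h div Q = 0")
  case False
  have "Q \<noteq> 0" using assms by auto
  then have d: "degree (h div Q * Q) = degree (h div Q) + degree Q" using False by (simp add: degree_mult_eq)
  have "degree (h mod Q) < degree Q" using assms \<open>Q \<noteq> 0\<close> by (metis degree_mod_less degree_0)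
  then have "degree (h div Q * Q + h mod Q) = degree (h div Q * Q)"
    using d by (intro degree_add_eq_left) simp
  then show ?thesis using d by simp
qed simp

text \<open>An expansion \<open>h = \<Sum>j. E\<^sub>j * Q ^ j\<close> with digits \<open>E\<^sub>j\<close> of degree below that of \<open>Q\<close> is represented by
  the polynomial \<open>E\<close> with polynomial coefficients, so that \<open>h\<close> is the value of \<open>E\<close> at \<open>Q\<close>.\<close>

lemma expansion_exists:
  fixes Q :: "'l::field poly"
  assumes S: "is_subring S" and Q: "over S Q" "lead_coeff Q = 1" "degree Q > 0" and h: "over S h"
  obtains E where "h = poly E Q" "\<And>j. over S (coeff E j)" "\<And>j. degree (coeff E j) < degree Q"
proof -
  have "\<exists>E. h = poly E Q \<and> (\<forall>j. over S (coeff E j) \<and> degree (coeff E j) < degree Q)"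
    using h
  proof (induction "degree h" arbitrary: h rule: less_induct)
    case less
    show ?case
    proof (cases "degree h < degree Q")
      case True
      then show ?thesis using less.prems Q
        by (intro exI[of _ "[:h:]"]) (auto simp: coeff_pCons over_closed[OF S] split: nat.splits)
    next
      case False
      have "degree (h div Q) < degree h"
        using degree_div_cases[OF Q(3), of h] False Q(3) by auto
      then obtain E where E: "h div Q = poly E Q"
        "\<And>j. over S (coeff E j) \<and> degree (coeff E j) < degree Q"
        using less.hyps over_divmod[OF S Q(1,2) less.prems] by metis
      have "Q \<noteq> 0" using Q by auto
      then have "degree (h mod Q) < degree Q" using Q(3) by (metis degree_mod_less degree_0)
      moreover have "h = poly (pCons (h mod Q) E) Q"
        using E(1) by (simp flip: E(1))
      ultimately show ?thesis using E(2) over_divmod[OF S Q(1,2) less.prems]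
        by (intro exI[of _ "pCons (h mod Q) E"]) (auto simp: coeff_pCons split: nat.splits)
    qed
  qed
  then show thesis using that by blast
qed

text \<open>The terms of an expansion have distinct degrees, so the top one decides.\<close>

lemma lead_coeff_expansion:
  fixes Q :: "'l::field poly"
  assumes Q: "lead_coeff Q = 1" "degree Q > 0"
    and E: "\<And>j. degree (coeff E j) < degree Q" "E \<noteq> 0"
  shows "poly E Q \<noteq> 0 \<and> degree (poly E Q) = degree (lead_coeff E) + degree Q * degree E
    \<and> lead_coeff (poly E Q) = lead_coeff (lead_coeff E)"
  using E
proof (induction E)
  case 0
  then show ?case by simp
next
  case (pCons a E)
  have a: "degree a < degree Q" using pCons.prems(1)[of 0] by simp
  have E: "degree (coeff E j) < degree Q" for j using pCons.prems(1)[of "Suc j"] by simp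
  show ?case
  proof (cases "E = 0")
    case True
    then show ?thesis using pCons by simp
  next
    case False
    note IH = pCons.IH[OF E False]
    have "Q \<noteq> 0" using Q by auto
    then have d: "degree (Q * poly E Q) = degree Q + degree (poly E Q)" using IH by (simp add: degree_mult_eq)
    have lt: "degree a < degree (Q * poly E Q)" using a d by simp
    have l: "lead_coeff (Q * poly E Q) = lead_coeff (poly E Q)" using Q by (simp add: lead_coeff_mult)
    have deg: "degree (a + Q * poly E Q) = degree (Q * poly E Q)" using lt by (rule degree_add_eq_right)
    have lead: "lead_coeff (a + Q * poly E Q) = lead_coeff (poly E Q)"
      using lead_coeff_add_le[OF lt] l by (simp add: add.commute)
    have nz: "a + Q * poly E Q \<noteq> 0"
    proof
      assume "a + Q * poly E Q = 0"
      then have "degree (a + Q * poly E Q) = 0" by (simp only: degree_0)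
      then show False using deg lt by linarith
    qed
    have step: "poly (pCons a E) Q = a + Q * poly E Q" "degree (pCons a E) = Suc (degree E)"
      "lead_coeff (pCons a E) = lead_coeff E" using False by auto
    have "degree (a + Q * poly E Q) = degree (lead_coeff E) + degree Q * Suc (degree E)"
      unfolding deg d using IH by (metis add.left_commute mult_Suc_right)
    then show ?thesis
      unfolding step(3) unfolding step(1,2) using nz lead IH by metis
  qed
qed

lemma expansion_unique:
  fixes Q :: "'l::field poly"
  assumes Q: "lead_coeff Q = 1" "degree Q > 0"
    and E: "\<And>j. degree (coeff E j) < degree Q" "\<And>j. degree (coeff F j) < degree Q"
    and eq: "poly E Q = poly F Q"
  shows "E = F"
proof (rule ccontr)
  assume "E \<noteq> F"
  then have "E - F \<noteq> 0" by simp
  moreover have "degree (coeff (E - F) j) < degree Q" for j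
    using degree_diff_less[OF E(1) E(2)] by simp
  ultimately have "poly (E - F) Q \<noteq> 0" using lead_coeff_expansion[OF Q] by blast
  then show False using eq by simp
qed

text \<open>The binomial theorem to first order. The degree bound on the remainder is what makes the linear term
  dominant when \<open>b\<close> has lower degree than \<open>H\<close>; the case \<open>R = 0\<close> is separate because for \<open>d = 0\<close> no
  natural number satisfies the bound.\<close>

lemma first_order_power:
  fixes H b :: "'l::field poly"
  assumes b: "degree b < degree H"
  shows "\<exists>R. (H + b) ^ Suc d = H ^ Suc d + of_nat (Suc d) * b * H ^ d + b\<^sup>2 * R
    \<and> (R = 0 \<or> degree R + degree H \<le> d * degree H)"
proof (induction d)
  case 0
  show ?case by (intro exI[of _ 0]) simp
next
  case (Suc d)
  then obtain R where R: "(H + b) ^ Suc d = H ^ Suc d + of_nat (Suc d) * b * H ^ d + b\<^sup>2 * R"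
    "R = 0 \<or> degree R + degree H \<le> d * degree H" by blast
  define T where "T = R * H + of_nat (Suc d) * H ^ d + b * R"
  have "(H + b) ^ Suc (Suc d) = (H + b) * (H + b) ^ Suc d" by (rule power_Suc)
  also have "\<dots> = H ^ Suc (Suc d) + of_nat (Suc (Suc d)) * b * H ^ Suc d + b\<^sup>2 * T"
    unfolding R(1) T_def by (simp add: algebra_simps power2_eq_square)
  finally have "(H + b) ^ Suc (Suc d) = H ^ Suc (Suc d) + of_nat (Suc (Suc d)) * b * H ^ Suc d + b\<^sup>2 * T" .
  moreover have "degree T \<le> d * degree H"
  proof -
    have 1: "degree (R * H) \<le> d * degree H" and 3: "degree (b * R) \<le> d * degree H"
      using R(2) b degree_mult_le[of R H] degree_mult_le[of b R] by auto
    have "degree (of_nat (Suc d) * H ^ d) \<le> degree (of_nat (Suc d) :: 'l poly) + degree (H ^ d)"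
      by (rule degree_mult_le)
    also have "\<dots> \<le> d * degree H" using degree_power_le[of H d] by (simp add: mult.commute del: of_nat_Suc)
    finally show ?thesis unfolding T_def using 1 3 by (intro degree_add_le) auto
  qed
  ultimately show ?case by (intro exI[of _ T]) auto
qed

section \<open>Valuations\<close>

text \<open>The additive convention is that of degrees: \<open>v\<close> is the negative of a valuation in the usual sense.
  Its value at \<open>0\<close> is unspecified.\<close>

locale valued_field =
  fixes v :: "'l::field \<Rightarrow> int"
  assumes v_mult: "a \<noteq> 0 \<Longrightarrow> b \<noteq> 0 \<Longrightarrow> v (a * b) = v a + v b"
    and v_add: "a \<noteq> 0 \<Longrightarrow> b \<noteq> 0 \<Longrightarrow> a + b \<noteq> 0 \<Longrightarrow> v (a + b) \<le> max (v a) (v b)"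
begin

lemma v_one: "v 1 = 0"
  using v_mult[of 1 1] by simp

lemma v_minus: "v (- a) = v a"
proof (cases "a = 0")
  case False
  have "v (-1) = 0" using v_mult[of "-1" "-1"] v_one by simp
  then show ?thesis using v_mult[of "-1" a] False by simp
qed simp

lemma v_power: "a \<noteq> 0 \<Longrightarrow> v (a ^ n) = int n * v a"
  by (induction n) (auto simp: v_one v_mult algebra_simps)

lemma v_inverse: "a \<noteq> 0 \<Longrightarrow> v (inverse a) = - v a"
  using v_mult[of a "inverse a"] v_one by simp

definition vle :: "'l \<Rightarrow> int \<Rightarrow> bool" where
  "vle a t \<longleftrightarrow> a = 0 \<or> v a \<le> t"

lemma vle_add: "vle a t \<Longrightarrow> vle b t \<Longrightarrow> vle (a + b) t"
  unfolding vle_def using v_add[of a b] by (metis add.left_neutral add.right_neutral max.bounded_iff order_trans)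

lemma vle_sum: "(\<And>i. i \<in> I \<Longrightarrow> vle (f i) t) \<Longrightarrow> vle (sum f I) t"
  by (induction I rule: infinite_finite_induct) (auto intro: vle_add, auto simp: vle_def)

lemma vle_mult: "vle a s \<Longrightarrow> vle b t \<Longrightarrow> vle (a * b) (s + t)"
  unfolding vle_def using v_mult[of a b] by (metis add_mono mult_eq_0_iff)

lemma vle_minus: "vle a t \<Longrightarrow> vle (- a) t"
  by (auto simp: vle_def v_minus)

text \<open>One bound is the ultrametric inequality; the other one comes from \<open>a = (a + b) - b\<close>.\<close>

lemma v_add_dominated:
  assumes "a \<noteq> 0" "vle b (v a - 1)"
  shows "a + b \<noteq> 0 \<and> v (a + b) = v a"
proof (cases "b = 0")
  case False
  then have b: "v b < v a" using assms by (auto simp: vle_def)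
  then have s: "a + b \<noteq> 0" using v_minus[of b] by (metis add_eq_0_iff2 less_irrefl)
  have "v (a + b) \<le> v a" using v_add[OF assms(1) False s] b by simp
  moreover have "v a \<le> max (v (a + b)) (v (- b))"
    using v_add[of "a + b" "- b"] s False assms by simp
  ultimately show ?thesis using s b by (auto simp: v_minus)
qed (use assms in auto)

text \<open>The nonzero summand of largest value dominates the sum of all others.\<close>

lemma sum_distinct_values:
  assumes I: "finite I" and nz: "\<exists>i\<in>I. f i \<noteq> 0"
    and dist: "\<And>i j. i \<in> I \<Longrightarrow> j \<in> I \<Longrightarrow> f i \<noteq> 0 \<Longrightarrow> f j \<noteq> 0 \<Longrightarrow> v (f i) = v (f j) \<Longrightarrow> i = j"
  shows "sum f I \<noteq> 0 \<and> (\<exists>i\<in>I. f i \<noteq> 0 \<and> v (sum f I) = v (f i) \<and> (\<forall>j\<in>I. f j \<noteq> 0 \<longrightarrow> v (f j) \<le> v (f i)))"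
proof -
  define J where "J = {i \<in> I. f i \<noteq> 0}"
  have J: "finite J" "J \<noteq> {}" using I nz by (auto simp: J_def)
  have "Max ((v \<circ> f) ` J) \<in> (v \<circ> f) ` J" using J by (intro Max_in) auto
  then obtain i where i: "i \<in> J" "v (f i) = Max ((v \<circ> f) ` J)" by auto
  have le: "v (f j) \<le> v (f i)" if "j \<in> J" for j
    using J that unfolding i(2) by (intro Max_ge) auto
  have "vle (sum f (I - {i})) (v (f i) - 1)"
  proof (intro vle_sum)
    fix j assume j: "j \<in> I - {i}"
    show "vle (f j) (v (f i) - 1)"
    proof (cases "f j = 0")
      case False
      then have "v (f j) \<noteq> v (f i)" using dist[of j i] i j by (auto simp: J_def)
      moreover have "v (f j) \<le> v (f i)" using False j by (intro le) (auto simp: J_def)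
      ultimately show ?thesis by (auto simp: vle_def)
    qed (auto simp: vle_def)
  qed
  moreover have "sum f I = f i + sum f (I - {i})"
    using i I by (intro sum.remove) (auto simp: J_def)
  ultimately show ?thesis
    using v_add_dominated[of "f i" "sum f (I - {i})"] i le by (auto simp: J_def)
qed

end

section \<open>Optimal polynomials\<close>

text \<open>\<open>K\<close> will be the field \<open>k(f)\<close> inside the Laurent series in \<open>1/z\<close>, and \<open>M\<close> the degree of \<open>f\<close>, so
  that a residue class modulo \<open>M\<close> is a class of values modulo those of \<open>K\<close>.\<close>

locale ramified_element = valued_field v for v :: "'l::field \<Rightarrow> int" +
  fixes K :: "'l set" and M :: int and y :: 'l
  assumes K: "is_subring K" and K_inverse: "a \<in> K \<Longrightarrow> inverse a \<in> K"
    and M_pos: "M > 0"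
    and K_value: "a \<in> K \<Longrightarrow> a \<noteq> 0 \<Longrightarrow> M dvd v a"
    and K_uniformizer: "\<exists>x\<in>K. x \<noteq> 0 \<and> v x = M"
begin

lemma K_value_exists: "\<exists>c\<in>K. c \<noteq> 0 \<and> v c = M * k"
proof -
  obtain x where x: "x \<in> K" "x \<noteq> 0" "v x = M" using K_uniformizer by blast
  show ?thesis
  proof (cases "k \<ge> 0")
    case True
    then show ?thesis using x subring_power[OF K x(1)]
      by (intro bexI[of _ "x ^ nat k"]) (auto simp: v_power)
  next
    case False
    then show ?thesis using x subring_power[OF K x(1)]
      by (intro bexI[of _ "inverse (x ^ nat (- k))"]) (auto simp: v_power v_inverse K_inverse)
  qed
qed

text \<open>An optimal polynomial realises a residue class of values modulo \<open>M\<close> that polynomials of lower degree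
  miss. Its value is then the least one among the values of monic polynomials of its degree,
  since no polynomial of lower degree can cancel its leading term.\<close>

definition opt :: "nat \<Rightarrow> 'l poly \<Rightarrow> bool" where
  "opt r h \<longleftrightarrow> over K h \<and> lead_coeff h = 1 \<and> degree h = r \<and> poly h y \<noteq> 0 \<and>
    (\<forall>q. over K q \<longrightarrow> q \<noteq> 0 \<longrightarrow> degree q < r \<longrightarrow> \<not> M dvd v (poly h y) - v (poly q y))"

lemma optD:
  assumes "opt r h"
  shows "over K h" "lead_coeff h = 1" "degree h = r" "poly h y \<noteq> 0"
    "over K q \<Longrightarrow> q \<noteq> 0 \<Longrightarrow> degree q < r \<Longrightarrow> \<not> M dvd v (poly h y) - v (poly q y)"
  using assms by (auto simp: opt_def)

text \<open>The values of \<open>h\<close> and \<open>b\<close> are incongruent, hence that of \<open>b\<close> is strictly smaller and the value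
  of \<open>h\<close> is kept.\<close>

lemma opt_add_lower:
  assumes h: "opt r h" and b: "over K b" "degree b < r" "vle (poly b y) (v (poly h y))"
  shows "opt r (h + b)"
proof (cases "b = 0")
  case False
  have "poly b y = 0 \<or> v (poly b y) \<noteq> v (poly h y)"
    using optD(5)[OF h b(1) False b(2)] by auto
  then have "vle (poly b y) (v (poly h y) - 1)" using b(3) by (auto simp: vle_def)
  from v_add_dominated[OF optD(4)[OF h] this]
  have val: "poly (h + b) y \<noteq> 0" "v (poly (h + b) y) = v (poly h y)" by auto
  have "degree (h + b) = degree h" using b(2) optD(3)[OF h] by (intro degree_add_eq_left) simp
  moreover have "coeff (h + b) r = 1" using optD(2,3)[OF h] b(2) by (simp add: coeff_eq_0)
  ultimately show ?thesis using val h b(1) unfolding opt_def by (auto simp: over_closed[OF K])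
qed (use h in simp)

lemma opt_one: "opt 0 1"
  by (auto simp: opt_def over_closed[OF K])

lemma opt_distinct_values:
  assumes "opt s g" "opt t h" "M dvd v (poly g y) - v (poly h y)"
  shows "s = t"
proof (rule ccontr)
  assume "s \<noteq> t"
  then consider "s < t" | "t < s" by linarith
  then show False
  proof cases
    case 1
    have "M dvd v (poly h y) - v (poly g y)" using assms(3) by (metis dvd_minus_iff minus_diff_eq)
    moreover have "g \<noteq> 0" using optD(4)[OF assms(1)] by auto
    ultimately show ?thesis using optD(5)[OF assms(2) optD(1)[OF assms(1)]] optD(3)[OF assms(1)] 1 by blast
  next
    case 2
    moreover have "h \<noteq> 0" using optD(4)[OF assms(2)] by auto
    ultimately show ?thesis using optD(5)[OF assms(1) optD(1)[OF assms(2)]] optD(3)[OF assms(2)] assms(3) by blast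
  qed
qed

text \<open>Optimal polynomials form a triangular basis whose values are pairwise incongruent modulo \<open>M\<close>, so there
  is no cancellation between different basis elements. The statement is about a subring \<open>S\<close> of \<open>K\<close> because
  it serves both for \<open>K\<close>, where the optimal polynomials are found, and for \<open>k[f]\<close>, where
  the nonnegativity of values matters.\<close>

lemma value_via_basis:
  assumes S: "is_subring S" "S \<subseteq> K" and H: "\<And>s. s < n \<Longrightarrow> over S (H s) \<and> opt s (H s)"
    and q: "over S q" "q \<noteq> 0" "degree q < n"
  shows "poly q y \<noteq> 0 \<and> (\<exists>s\<le>degree q. \<exists>c\<in>S. c \<noteq> 0 \<and> v (poly q y) = v c + v (poly (H s) y))"
  using q
proof (induction "degree q" arbitrary: q rule: less_induct)
  case less
  define s where "s = degree q"
  define c where "c = lead_coeff q"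
  have s: "s < n" "over S (H s)" "opt s (H s)" using less.prems H by (auto simp: s_def)
  have c: "c \<in> S" "c \<noteq> 0" "c \<in> K" using less.prems S(2) by (auto simp: c_def over_def)
  define p where "p = q - [:c:] * H s"
  have p_over: "over S p" unfolding p_def using less.prems(1) s(2) c(1)
    by (intro over_closed(3,6)[OF S(1)]) (auto simp: over_pCons over_closed[OF S(1)])
  have Hs: "lead_coeff (H s) = 1" "degree (H s) = s" "poly (H s) y \<noteq> 0" using optD[OF s(3)] by auto
  have cH: "c * poly (H s) y \<noteq> 0" "v (c * poly (H s) y) = v c + v (poly (H s) y)"
    using c(2) Hs(3) by (auto simp: v_mult)
  have qy: "poly q y = c * poly (H s) y + poly p y" by (simp add: p_def)
  show ?case
  proof (cases "p = 0")
    case True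
    then show ?thesis using qy cH c by (intro conjI exI[of _ s] bexI[of _ c]) (auto simp: s_def)
  next
    case False
    have "coeff p i = 0" if "i \<ge> s" for i
      using that Hs by (cases "i = s") (auto simp: p_def c_def s_def coeff_eq_0)
    then have dp: "degree p < s" using False by (intro degree_lessI) auto
    obtain t e where t: "t \<le> degree p" "e \<in> S" "e \<noteq> 0" "v (poly p y) = v e + v (poly (H t) y)" "poly p y \<noteq> 0"
      using less.hyps[of p] dp p_over False s(1) by (auto simp: s_def)
    have "\<not> M dvd v (poly (H s) y) - v (poly p y)"
      using optD(5)[OF s(3) over_mono[OF p_over S(2)] False dp] .
    then have ne: "v (c * poly (H s) y) \<noteq> v (poly p y)"
      using K_value[OF c(3) c(2)] unfolding cH(2)
      by (metis add_diff_cancel_right' dvd_minus_iff minus_diff_eq)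
    show ?thesis
    proof (cases "v (poly p y) < v (c * poly (H s) y)")
      case True
      then have "poly q y \<noteq> 0 \<and> v (poly q y) = v (c * poly (H s) y)"
        using v_add_dominated[OF cH(1), of "poly p y"] qy by (auto simp: vle_def)
      then show ?thesis using cH c by (intro conjI exI[of _ s] bexI[of _ c]) (auto simp: s_def)
    next
      case False
      then have "poly q y \<noteq> 0 \<and> v (poly q y) = v (poly p y)"
        using v_add_dominated[OF t(5), of "c * poly (H s) y"] qy ne by (auto simp: vle_def add.commute)
      then show ?thesis using t dp by (intro conjI exI[of _ t] bexI[of _ e]) (auto simp: s_def)
    qed
  qed
qed

end

section \<open>Levels\<close>

text \<open>The last assumption says that the valuation ring of \<open>K\<close> has only one extension to \<open>K(y)\<close>, given by
  \<open>v\<close>: the elements of value zero are integral over it. Geometrically, the curve has one place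
  at infinity.\<close>

locale one_place = ramified_element +
  fixes P :: "'a poly"
  assumes P_over: "over K P" and P_monic: "lead_coeff P = 1" and P_root: "poly P y = 0"
    and P_minimal: "over K h \<Longrightarrow> h \<noteq> 0 \<Longrightarrow> degree h < degree P \<Longrightarrow> poly h y \<noteq> 0"
    and opt_exists: "r < degree P \<Longrightarrow> \<exists>h. opt r h"
    and integral: "over K h \<Longrightarrow> poly h y \<noteq> 0 \<Longrightarrow> v (poly h y) = 0 \<Longrightarrow>
      \<exists>C. over K C \<and> (\<forall>i. vle (coeff C i) 0) \<and> lead_coeff C = 1 \<and> poly C (poly h y) = 0"
begin

abbreviation N :: nat where "N \<equiv> degree P"

lemma N_pos: "N > 0"
proof (rule ccontr)
  assume "\<not> N > 0"
  then have "P = 1" using P_monic by (auto elim!: degree_eq_zeroE simp: one_pCons)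
  then show False using P_root by simp
qed

text \<open>A level is a degree below which the polynomials behave with respect to values as if they formed a field with value group
  \<open>d\<int>\<close>: their values are closed under addition although their products may have higher degree.\<close>

definition level :: "nat \<Rightarrow> int \<Rightarrow> bool" where
  "level r d \<longleftrightarrow> r > 0 \<and> r \<le> N \<and> d > 0 \<and>
    (\<forall>q. over K q \<longrightarrow> q \<noteq> 0 \<longrightarrow> degree q < r \<longrightarrow> d dvd v (poly q y)) \<and>
    (\<forall>j. d dvd j \<longrightarrow> (\<exists>q. over K q \<and> q \<noteq> 0 \<and> degree q < r \<and> v (poly q y) = j))"

lemma levelD:
  assumes "level r d"
  shows "r > 0" "r \<le> N" "d > 0"
    "over K q \<Longrightarrow> q \<noteq> 0 \<Longrightarrow> degree q < r \<Longrightarrow> d dvd v (poly q y)"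
    "d dvd j \<Longrightarrow> \<exists>q. over K q \<and> q \<noteq> 0 \<and> degree q < r \<and> v (poly q y) = j"
  using assms by (auto simp: level_def)

lemma level_nonzero:
  assumes "level r d" "over K q" "q \<noteq> 0" "degree q < r"
  shows "poly q y \<noteq> 0"
  using P_minimal[OF assms(2,3)] levelD(2)[OF assms(1)] assms(4) by simp

lemma level_one: "level 1 M"
proof -
  have "M dvd v (poly q y)" if "over K q" "q \<noteq> 0" "degree q < 1" for q
    using that K_value by (auto elim!: degree_eq_zeroE simp: over_pCons)
  moreover have "\<exists>q. over K q \<and> q \<noteq> 0 \<and> degree q < 1 \<and> v (poly q y) = j" if j: "M dvd j" for j
  proof -
    obtain k where k: "j = M * k" using j by blast
    obtain c where c: "c \<in> K" "c \<noteq> 0" "v c = M * k" using K_value_exists by blast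
    then show ?thesis using k by (intro exI[of _ "[:c:]"]) (auto simp: over_pCons over_closed[OF K])
  qed
  ultimately show ?thesis using N_pos M_pos by (auto simp: level_def)
qed

text \<open>The order of \<open>e\<close> modulo \<open>d\<close> is \<open>d div gcd d e\<close>.\<close>

lemma dvd_mult_lt_imp_zero:
  fixes d e k :: int
  assumes d: "d > 0" and k: "\<bar>k\<bar> < d div gcd d e" and dvd: "d dvd k * e"
  shows "k = 0"
proof -
  define g where "g = gcd d e"
  have g: "g > 0" using d by (simp add: g_def)
  have "d = g * (d div g)" "e = g * (e div g)" by (auto simp: g_def)
  then have "g * (d div g) dvd g * (k * (e div g))" using dvd by (metis mult.left_commute)
  then have "d div g dvd k * (e div g)" using g by simp
  moreover have "coprime (d div g) (e div g)" using d by (simp add: g_def div_gcd_coprime)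
  ultimately have "d div g dvd k" by (simp add: coprime_dvd_mult_left_iff)
  then show "k = 0" using k dvd_imp_le_int[of k "d div g"] by (fastforce simp: g_def)
qed

lemma poly_expansion: "poly (poly E Q) y = (\<Sum>j\<le>degree E. poly (coeff E j) y * poly Q y ^ j)"
  by (simp add: poly_altdef[of E] poly_sum)

context
  fixes r :: nat and d :: int and Q :: "'a poly"
  assumes level: "level r d" and rN: "r < N" and Q: "opt r Q"
begin

text \<open>The order of the value of \<open>Q\<close> modulo \<open>d\<close>: the index by which \<open>Q\<close> enlarges the group of values.\<close>

definition ram_index :: nat where
  "ram_index = nat (d div gcd d (v (poly Q y)))"

lemma Q_facts: "lead_coeff Q = 1" "degree Q > 0" "degree Q = r" "over K Q" "Q \<noteq> 0" "poly Q y \<noteq> 0"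
  using optD[OF Q] levelD(1)[OF level] by auto

lemma not_dvd_value: "\<not> d dvd v (poly Q y)"
proof
  assume "d dvd v (poly Q y)"
  then obtain q where "over K q" "q \<noteq> 0" "degree q < r" "v (poly q y) = v (poly Q y)"
    using levelD(5)[OF level] by blast
  then show False using optD(5)[OF Q, of q] by simp
qed

lemma ram_index_times_gcd: "int ram_index * gcd d (v (poly Q y)) = d"
  using levelD(3)[OF level] unfolding ram_index_def by (simp add: pos_imp_zdiv_nonneg_iff)

lemma ram_index_ge_2: "ram_index \<ge> 2"
proof -
  have "ram_index \<noteq> 0"
  proof
    assume "ram_index = 0"
    then show False using ram_index_times_gcd levelD(3)[OF level] by simp
  qed
  moreover have "ram_index \<noteq> 1"
  proof
    assume "ram_index = 1"
    then have "gcd d (v (poly Q y)) = d" using ram_index_times_gcd by simp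
    then show False using not_dvd_value by (metis gcd_dvd2)
  qed
  ultimately show ?thesis by simp
qed

lemma ram_index_cancel:
  assumes "i < ram_index" "j < ram_index" "d dvd (int i - int j) * v (poly Q y)"
  shows "i = j"
proof -
  have "\<bar>int i - int j\<bar> < d div gcd d (v (poly Q y))"
    using assms(1,2) unfolding ram_index_def by linarith
  then show ?thesis using dvd_mult_lt_imp_zero[OF levelD(3)[OF level] _ assms(3)] by simp
qed

text \<open>The terms of an expansion with fewer than \<open>ram_index\<close> digits have values in different cosets of
  \<open>d\<int>\<close>, so one of them dominates.\<close>

lemma expansion_value:
  assumes E: "E \<noteq> 0" "\<And>j. over K (coeff E j)" "\<And>j. degree (coeff E j) < r" "degree E < ram_index"
  shows "poly (poly E Q) y \<noteq> 0 \<and> (\<exists>j\<le>degree E. coeff E j \<noteq> 0 \<and>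
    v (poly (poly E Q) y) = v (poly (coeff E j) y) + int j * v (poly Q y))"
proof -
  let ?f = "\<lambda>j. poly (coeff E j) y * poly Q y ^ j"
  have nz: "?f j \<noteq> 0 \<longleftrightarrow> coeff E j \<noteq> 0" for j
    using level_nonzero[OF level E(2) _ E(3)] Q_facts(6) by auto
  have val: "v (?f j) = v (poly (coeff E j) y) + int j * v (poly Q y)" if "coeff E j \<noteq> 0" for j
    using level_nonzero[OF level E(2) that E(3)] Q_facts(6) by (simp add: v_mult v_power)
  have "sum ?f {..degree E} \<noteq> 0 \<and> (\<exists>j\<in>{..degree E}. ?f j \<noteq> 0 \<and> v (sum ?f {..degree E}) = v (?f j) \<and>
    (\<forall>i\<in>{..degree E}. ?f i \<noteq> 0 \<longrightarrow> v (?f i) \<le> v (?f j)))"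
  proof (rule sum_distinct_values)
    show "\<exists>i\<in>{..degree E}. ?f i \<noteq> 0"
      using E(1) nz by (intro bexI[of _ "degree E"]) auto
    fix i j assume ij: "i \<in> {..degree E}" "j \<in> {..degree E}" "?f i \<noteq> 0" "?f j \<noteq> 0" "v (?f i) = v (?f j)"
    then have "v (poly (coeff E i) y) + int i * v (poly Q y) = v (poly (coeff E j) y) + int j * v (poly Q y)"
      using val nz by metis
    then have "(int i - int j) * v (poly Q y) = v (poly (coeff E j) y) - v (poly (coeff E i) y)"
      by (simp add: algebra_simps)
    moreover have "d dvd v (poly (coeff E j) y) - v (poly (coeff E i) y)"
      using levelD(4)[OF level E(2) _ E(3)] ij nz by (intro dvd_diff) auto
    ultimately show "i = j" using ram_index_cancel[of i j] ij E(4) by auto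
  qed auto
  then show ?thesis unfolding poly_expansion using val nz by auto
qed

lemma degree_expansion_lt:
  assumes "\<And>j. degree (coeff E j) < r" "degree (poly E Q) < r * k"
  shows "degree E < k \<or> E = 0"
proof (cases "E = 0")
  case False
  then have "degree (poly E Q) \<ge> r * degree E"
    using lead_coeff_expansion[of Q E] Q_facts assms(1) by auto
  then have "r * degree E < r * k" using assms(2) by linarith
  then show ?thesis by simp
qed simp

text \<open>Expansions with fewer than \<open>ram_index\<close> digits never vanish at \<open>y\<close>, so \<open>P\<close> is not among them, which gives
  \<open>r * ram_index \<le> N\<close>. Their values fill the group generated by \<open>d\<close> and the value of \<open>Q\<close>.\<close>

lemma level_step: "level (r * ram_index) (gcd d (v (poly Q y)))"
proof -
  let ?\<delta> = "v (poly Q y)" and ?g = "gcd d (v (poly Q y))"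
  have exp: "\<exists>E. q = poly E Q \<and> E \<noteq> 0 \<and> (\<forall>j. over K (coeff E j) \<and> degree (coeff E j) < r) \<and> degree E < ram_index"
    if q: "over K q" "q \<noteq> 0" "degree q < r * ram_index" for q
  proof -
    obtain E where E: "q = poly E Q" "\<And>j. over K (coeff E j)" "\<And>j. degree (coeff E j) < degree Q"
      using expansion_exists[OF K Q_facts(4,1,2) q(1)] by blast
    have "E \<noteq> 0" using q(2) E(1) by auto
    moreover have "degree E < ram_index \<or> E = 0"
      using degree_expansion_lt[of E ram_index] q(3) E Q_facts(3) by simp
    ultimately show ?thesis using E Q_facts(3) by auto
  qed
  have "r * ram_index \<le> N"
  proof (rule ccontr)
    assume "\<not> r * ram_index \<le> N"
    then obtain E where "P = poly E Q" "E \<noteq> 0" "\<forall>j. over K (coeff E j) \<and> degree (coeff E j) < r" "degree E < ram_index"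
      using exp[OF P_over] P_monic by force
    then show False using expansion_value[of E] P_root by auto
  qed
  moreover have "?g dvd v (poly q y)" if q: "over K q" "q \<noteq> 0" "degree q < r * ram_index" for q
  proof -
    obtain E where E: "q = poly E Q" "E \<noteq> 0" "\<And>j. over K (coeff E j)" "\<And>j. degree (coeff E j) < r" "degree E < ram_index"
      using exp[OF q] by blast
    obtain j where "coeff E j \<noteq> 0" "v (poly q y) = v (poly (coeff E j) y) + int j * ?\<delta>"
      using expansion_value[OF E(2-5)] E(1) by auto
    moreover from this have "d dvd v (poly (coeff E j) y)" using levelD(4)[OF level E(3) _ E(4)] by blast
    ultimately show ?thesis by (auto intro!: dvd_add intro: dvd_trans[OF gcd_dvd1])
  qed
  moreover have "\<exists>q. over K q \<and> q \<noteq> 0 \<and> degree q < r * ram_index \<and> v (poly q y) = t" if t: "?g dvd t" for t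
  proof -
    obtain k where k: "t = ?g * k" using t by blast
    obtain a b where ab: "a * d + b * ?\<delta> = ?g" using bezout_int by blast
    \<comment> \<open>\<open>t\<close> is congruent to \<open>(b * k) * v (poly Q y)\<close> modulo \<open>d\<close>; reducing the factor modulo the order of the value of \<open>Q\<close> gives the exponent.\<close>
    define j where "j = nat ((b * k) mod int ram_index)"
    have ipos: "int ram_index > 0" using ram_index_ge_2 by simp
    then have j: "int j = (b * k) mod int ram_index" "j < ram_index"
      unfolding j_def by (auto simp: nat_less_iff)
    have "d dvd t - int j * ?\<delta>"
    proof -
      have "d dvd int ram_index * ?\<delta>"
        using mult_dvd_mono[OF dvd_refl gcd_dvd2, of "int ram_index" d ?\<delta>] unfolding ram_index_times_gcd .
      then have "d dvd (b * k) div int ram_index * (int ram_index * ?\<delta>)" by (rule dvd_mult)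
      moreover have "b * k - int j = int ram_index * ((b * k) div int ram_index)"
        unfolding j(1) by (simp add: minus_mod_eq_mult_div)
      then have "(b * k - int j) * ?\<delta> = (b * k) div int ram_index * (int ram_index * ?\<delta>)" by (simp only: ac_simps)
      ultimately have "d dvd (b * k - int j) * ?\<delta>" by (simp only:)
      moreover have "t - int j * ?\<delta> = (a * k) * d + (b * k - int j) * ?\<delta>"
        unfolding k by (subst ab[symmetric]) (simp add: algebra_simps)
      ultimately show ?thesis by (simp only: dvd_add dvd_mult dvd_refl)
    qed
    then obtain q where q: "over K q" "q \<noteq> 0" "degree q < r" "v (poly q y) = t - int j * ?\<delta>"
      using levelD(5)[OF level] by blast
    have "degree (q * Q ^ j) = degree q + j * r"
      using q Q_facts by (simp add: degree_mult_eq degree_power_eq)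
    also have "\<dots> < Suc j * r" using q(3) by simp
    also have "\<dots> \<le> ram_index * r" using j(2) by (intro mult_right_mono) auto
    finally have "degree (q * Q ^ j) < r * ram_index" by (simp add: mult.commute)
    moreover have "v (poly (q * Q ^ j) y) = t"
      using q Q_facts level_nonzero[OF level q(1-3)] by (simp add: v_mult v_power)
    moreover have "over K (q * Q ^ j)" using q Q_facts by (intro over_closed(6)[OF K] over_power[OF K])
    moreover have "q * Q ^ j \<noteq> 0" using q Q_facts by auto
    ultimately show ?thesis by blast
  qed
  moreover have "?g > 0" "r * ram_index > 0"
    using levelD(1,3)[OF level] ram_index_ge_2 by auto
  ultimately show ?thesis unfolding level_def by auto
qed

text \<open>Compare with an expansion of lower degree: modulo \<open>d\<close> its dominating term must be a multiple of \<open>Q ^ j\<close>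
  itself, and then its digit of index \<open>j\<close> would contradict the optimality of \<open>h\<close>.\<close>

lemma opt_mult_power:
  assumes h: "opt s h" and s: "s < r" and j: "j < ram_index"
  shows "opt (j * r + s) (Q ^ j * h)"
  unfolding opt_def
proof (intro conjI allI impI)
  have h0: "h \<noteq> 0" "poly h y \<noteq> 0" using optD[OF h] by auto
  show "over K (Q ^ j * h)" using optD(1)[OF h] Q_facts by (intro over_closed(6)[OF K] over_power[OF K])
  show "lead_coeff (Q ^ j * h) = 1" using optD(2)[OF h] Q_facts
    by (simp add: lead_coeff_mult lead_coeff_power)
  show "degree (Q ^ j * h) = j * r + s" using optD(3)[OF h] h0 Q_facts
    by (simp add: degree_mult_eq degree_power_eq)
  show "poly (Q ^ j * h) y \<noteq> 0" using h0 Q_facts by simp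
  have val: "v (poly (Q ^ j * h) y) = int j * v (poly Q y) + v (poly h y)"
    using h0 Q_facts by (simp add: v_mult v_power)
  fix q assume q: "over K q" "q \<noteq> 0" "degree q < j * r + s"
  show "\<not> M dvd v (poly (Q ^ j * h) y) - v (poly q y)"
  proof
    assume M: "M dvd v (poly (Q ^ j * h) y) - v (poly q y)"
    obtain E where E: "q = poly E Q" "\<And>j. over K (coeff E j)" "\<And>j. degree (coeff E j) < r"
      using expansion_exists[OF K Q_facts(4,1,2) q(1)] unfolding Q_facts(3) by blast
    have E0: "E \<noteq> 0" using q(2) E(1) by auto
    have deg: "degree q = degree (lead_coeff E) + r * degree E"
      using lead_coeff_expansion[of Q E] Q_facts E E0 by auto
    have "degree E < Suc j"
      using degree_expansion_lt[OF E(3), of "Suc j"] E0 q(3) E(1) s by (simp add: algebra_simps)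
    then have dE: "degree E \<le> j" by simp
    obtain i where i: "i \<le> degree E" "coeff E i \<noteq> 0"
      "v (poly q y) = v (poly (coeff E i) y) + int i * v (poly Q y)"
      using expansion_value[OF E0 E(2,3)] dE j E(1) by auto
    have dd: "d dvd M"
    proof -
      obtain c where c: "c \<in> K" "c \<noteq> 0" "v c = M * 1" using K_value_exists by blast
      have "over K [:c:]" using c by (auto simp: over_pCons over_closed[OF K])
      then show ?thesis using levelD(4)[OF level, of "[:c:]"] levelD(1)[OF level] c by simp
    qed
    have diff: "v (poly (Q ^ j * h) y) - v (poly q y)
      = (int j - int i) * v (poly Q y) + (v (poly h y) - v (poly (coeff E i) y))"
      unfolding val i(3) by (simp add: algebra_simps)
    have "d dvd v (poly h y)" using levelD(4)[OF level optD(1)[OF h] h0(1)] optD(3)[OF h] s by simp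
    moreover have "d dvd v (poly (coeff E i) y)" by (rule levelD(4)[OF level E(2) i(2) E(3)])
    ultimately have "d dvd (int j - int i) * v (poly Q y)"
      using dvd_trans[OF dd M] unfolding diff by (simp add: dvd_add_left_iff)
    then have ij: "j = i" using ram_index_cancel[of j i] j i(1) dE by auto
    then have "degree E = i" using i(1) dE by linarith
    then have "degree q = degree (coeff E i) + r * i" using deg by (simp only:)
    moreover have "degree q < r * i + s" using q(3) unfolding ij by (simp only: mult.commute)
    ultimately have "degree (coeff E i) < s" by linarith
    moreover have "M dvd v (poly h y) - v (poly (coeff E i) y)"
      using M unfolding diff by (simp add: ij)
    ultimately show False using optD(5)[OF h E(2) i(2)] by blast
  qed
qed

end

text \<open>The chain of levels can only stop at \<open>N\<close>, and every level divides the next one.\<close>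

lemma level_dvd: "level r d \<Longrightarrow> r dvd N"
proof (induction "N - r" arbitrary: r d rule: less_induct)
  case less
  show ?case
  proof (cases "r < N")
    case True
    then obtain Q where Q: "opt r Q" using opt_exists by blast
    note step = level_step[OF less.prems True Q]
    have lt: "r < r * ram_index d Q"
      using ram_index_ge_2[OF less.prems True Q] levelD(1)[OF less.prems] by simp
    then have "r * ram_index d Q dvd N"
      by (intro less.hyps[OF _ step] diff_less_mono2 lt True)
    then show ?thesis by (rule dvd_mult_left)
  qed (use levelD(2)[OF less.prems] in auto)
qed

end

section \<open>The slope of the minimal polynomial\<close>

lemma sum_mod_poly: "(\<Sum>i\<in>I. f i) mod Q = (\<Sum>i\<in>I. f i mod (Q::'l::field poly))"
  by (induction I rule: infinite_finite_induct) (auto simp: poly_mod_add_left)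

lemma sum_div_poly: "(\<Sum>i\<in>I. f i) div Q = (\<Sum>i\<in>I. f i div (Q::'l::field poly))"
  by (induction I rule: infinite_finite_induct) (auto simp: poly_div_add_left)

text \<open>A polynomial in \<open>Q\<close> whose coefficients have degree below twice that of \<open>Q\<close> becomes an expansion after
  a single round of carries.\<close>

lemma poly_carry:
  fixes Q :: "'l::field poly"
  shows "poly (map_poly (\<lambda>p. p mod Q) F + pCons 0 (map_poly (\<lambda>p. p div Q) F)) Q = poly F Q"
proof (induction F)
  case (pCons a F)
  have "map_poly (\<lambda>p. p mod Q) (pCons a F) = pCons (a mod Q) (map_poly (\<lambda>p. p mod Q) F)"
    "map_poly (\<lambda>p. p div Q) (pCons a F) = pCons (a div Q) (map_poly (\<lambda>p. p div Q) F)"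
    by (auto intro!: poly_eqI simp: coeff_map_poly coeff_pCons split: nat.splits)
  moreover have "a mod Q + Q * (a div Q) = a" by simp
  ultimately show ?case using pCons.IH by (simp add: distrib_left flip: pCons.IH)
qed simp

context one_place
begin

text \<open>The values of the terms of an expansion. Their maximum is the augmented valuation of MacLane attached
  to \<open>Q\<close>, which may exceed the value of the polynomial at \<open>y\<close>.\<close>

definition weight :: "'a poly \<Rightarrow> 'a poly poly \<Rightarrow> nat \<Rightarrow> int" where
  "weight Q E j = v (poly (coeff E j) y) + int j * v (poly Q y)"

text \<open>Among the digits of maximal weight, take the last one.\<close>

lemma top_index_exists:
  assumes "E \<noteq> 0"
  obtains i where "coeff E i \<noteq> 0" "\<And>j. coeff E j \<noteq> 0 \<Longrightarrow> weight Q E j \<le> weight Q E i"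
    "\<And>j. coeff E j \<noteq> 0 \<Longrightarrow> j > i \<Longrightarrow> weight Q E j < weight Q E i"
proof -
  define I where "I = {j. coeff E j \<noteq> 0}"
  have "I \<subseteq> {..degree E}" by (auto simp: I_def le_degree)
  then have I: "finite I" "I \<noteq> {}" using assms
    by (auto simp: I_def intro: finite_subset exI[of _ "degree E"])
  define w where "w = Max (weight Q E ` I)"
  define J where "J = {j \<in> I. weight Q E j = w}"
  have w: "w \<in> weight Q E ` I" unfolding w_def using I by (intro Max_in) auto
  have le: "weight Q E j \<le> w" if "j \<in> I" for j unfolding w_def using I that by (intro Max_ge) auto
  have J: "finite J" "J \<noteq> {}" using I w by (auto simp: J_def)
  have m: "Max J \<in> J" by (rule Max_in[OF J])
  have "j \<le> Max J" if "j \<in> J" for j using J that by (intro Max_ge) auto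
  then have "weight Q E j < w" if "j \<in> I" "j > Max J" for j
    using that le[of j] by (fastforce simp: J_def)
  then show thesis using m le by (intro that[of "Max J"]) (auto simp: J_def I_def)
qed

context
  fixes r :: nat and d :: int and Q :: "'a poly"
  assumes level: "level r d" and rN: "r < N" and Q: "opt r Q"
begin

lemmas Qf = Q_facts[OF level rN Q]

text \<open>In \<open>X * Y = A * Q + B\<close> the values of \<open>X * Y\<close> and \<open>B\<close> are multiples of \<open>d\<close> while that of \<open>A * Q\<close> is not.
  Hence no cancellation takes place on the right, and the value of the left-hand side is that of \<open>B\<close>.\<close>

lemma mod_carries_value:
  assumes X: "over K X" "X \<noteq> 0" "degree X < r" and Y: "over K Y" "Y \<noteq> 0" "degree Y < r"
  shows "poly (X * Y mod Q) y \<noteq> 0 \<and> v (poly (X * Y mod Q) y) = v (poly X y) + v (poly Y y) \<and>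
    vle (poly (X * Y div Q) y) (v (poly X y) + v (poly Y y) - v (poly Q y) - 1) \<and>
    degree (X * Y div Q) < r"
proof -
  define A B where "A = X * Y div Q" and "B = X * Y mod Q"
  have over: "over K A" "over K B" unfolding A_def B_def
    using over_divmod[OF K Qf(4,1) over_closed(6)[OF K X(1) Y(1)]] by auto
  have dB: "degree B < r" unfolding B_def using degree_mod_less[OF Qf(5), of "X * Y"] Qf by auto
  have dA: "degree A < r"
  proof -
    have "degree (X * Y) < r + r" using X Y by (simp add: degree_mult_eq)
    then show ?thesis using degree_div_cases[OF Qf(2), of "X * Y"] Qf(2,3) unfolding A_def by auto
  qed
  have x: "poly X y \<noteq> 0" "poly Y y \<noteq> 0"
    using level_nonzero[OF level] X Y by auto
  have eq: "poly X y * poly Y y = poly A y * poly Q y + poly B y"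
    unfolding A_def B_def by (simp flip: poly_mult poly_add)
  let ?t = "v (poly X y) + v (poly Y y)"
  have t: "v (poly X y * poly Y y) = ?t" using x by (simp add: v_mult)
  have dt: "d dvd ?t" using levelD(4)[OF level] X Y by auto
  have dvB: "d dvd v (poly B y)" if "B \<noteq> 0" using levelD(4)[OF level over(2) that dB] .
  have AQ: "poly A y * poly Q y \<noteq> 0 \<and> \<not> d dvd v (poly A y * poly Q y) \<and>
      v (poly A y * poly Q y) = v (poly A y) + v (poly Q y)" if "A \<noteq> 0"
  proof -
    have "poly A y \<noteq> 0" using level_nonzero[OF level over(1) that dA] .
    moreover have "d dvd v (poly A y)" using levelD(4)[OF level over(1) that dA] .
    ultimately show ?thesis using Qf(6) not_dvd_value[OF level rN Q]
      by (simp add: v_mult dvd_add_right_iff)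
  qed
  have B0: "B \<noteq> 0"
  proof
    assume "B = 0"
    then show False using eq AQ t dt x by fastforce
  qed
  then have b: "poly B y \<noteq> 0" using level_nonzero[OF level over(2) _ dB] by simp
  have "v (poly B y) = ?t \<and> vle (poly A y) (?t - v (poly Q y) - 1)"
  proof (cases "A = 0")
    case True
    then show ?thesis using eq t by (simp add: vle_def)
  next
    case False
    let ?a = "poly A y * poly Q y"
    have a: "?a \<noteq> 0" "\<not> d dvd v ?a" "v ?a = v (poly A y) + v (poly Q y)" using AQ[OF False] by auto
    have ne: "v ?a \<noteq> v (poly B y)" using a dvB[OF B0] by auto
    show ?thesis
    proof (cases "v ?a < v (poly B y)")
      case True
      then show ?thesis using v_add_dominated[OF b, of ?a] eq t a by (auto simp: vle_def add.commute)
    next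
      case False
      then have "v (?a + poly B y) = v ?a" using v_add_dominated[OF a(1), of "poly B y"] ne by (auto simp: vle_def)
      then show ?thesis using eq t dt a by simp
    qed
  qed
  then show ?thesis using b dA unfolding A_def B_def by blast
qed

text \<open>A product attains the sum of the two maximal weights, by the argument of the lemma of Gauss:
  at index \<open>a + b\<close> the product
  of the two top digits has the sum of the two maximal weights, and every other contribution,
  including the carries from index \<open>a + b - 1\<close>, has strictly smaller value.\<close>

lemma weight_product:
  assumes X: "\<And>j. over K (coeff X j)" "\<And>j. degree (coeff X j) < r"
    and Y: "\<And>j. over K (coeff Y j)" "\<And>j. degree (coeff Y j) < r"
    and Z: "\<And>j. degree (coeff Z j) < r" "poly Z Q = poly X Q * poly Y Q"
    and a: "coeff X a \<noteq> 0" "\<And>j. coeff X j \<noteq> 0 \<Longrightarrow> weight Q X j \<le> weight Q X a"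
      "\<And>j. coeff X j \<noteq> 0 \<Longrightarrow> j > a \<Longrightarrow> weight Q X j < weight Q X a"
    and b: "coeff Y b \<noteq> 0" "\<And>j. coeff Y j \<noteq> 0 \<Longrightarrow> weight Q Y j \<le> weight Q Y b"
      "\<And>j. coeff Y j \<noteq> 0 \<Longrightarrow> j > b \<Longrightarrow> weight Q Y j < weight Q Y b"
  shows "coeff Z (a + b) \<noteq> 0 \<and> weight Q Z (a + b) = weight Q X a + weight Q Y b"
proof -
  let ?\<delta> = "v (poly Q y)" and ?T = "weight Q X a + weight Q Y b"
  define F where "F = X * Y"
  define L where "L = (\<lambda>i j. coeff X i * coeff Y j)"
  have coeffF: "coeff F l = (\<Sum>i\<le>l. L i (l - i))" for l
    by (simp add: F_def L_def coeff_mult)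
  have "Z = map_poly (\<lambda>p. p mod Q) F + pCons 0 (map_poly (\<lambda>p. p div Q) F)" (is "_ = ?Z")
  proof (rule expansion_unique[of Q])
    have "degree (coeff ?Z j) < degree Q" for j
    proof -
      have "degree (coeff F i div Q) < degree Q" for i
      proof -
        have "degree (coeff F i) \<le> 2 * (r - 1)"
          unfolding coeffF
        proof (rule degree_sum_le)
          fix k
          have "degree (L k (i - k)) \<le> degree (coeff X k) + degree (coeff Y (i - k))"
            unfolding L_def by (rule degree_mult_le)
          then show "degree (L k (i - k)) \<le> 2 * (r - 1)" using X(2)[of k] Y(2)[of "i - k"] by linarith
        qed simp
        then show ?thesis using degree_div_cases[OF Qf(2), of "coeff F i"] Qf(2,3) by auto
      qed
      moreover have "degree (p mod Q) < degree Q" for p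
        using degree_mod_less[OF Qf(5), of p] Qf(2) by auto
      ultimately show ?thesis
        by (cases j) (auto simp: coeff_map_poly intro!: degree_add_less)
    qed
    then show "\<And>j. degree (coeff ?Z j) < degree Q" .
    show "poly Z Q = poly ?Z Q" unfolding poly_carry F_def using Z(2) by simp
  qed (use Z(1) Qf in auto)
  then have coeffZ: "coeff Z l = coeff F l mod Q + (if l = 0 then 0 else coeff F (l - 1) div Q)" for l
    by (cases l) (auto simp: coeff_map_poly)
  have main: "poly (L a b mod Q) y \<noteq> 0" "v (poly (L a b mod Q) y) = ?T - int (a + b) * ?\<delta>"
    using mod_carries_value[OF X(1) a(1) X(2) Y(1) b(1) Y(2)]
    by (auto simp: L_def weight_def algebra_simps)
  have small_mod: "vle (poly (L i j mod Q) y) (?T - int (a + b) * ?\<delta> - 1)"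
    if "i + j = a + b" "i \<noteq> a" for i j
  proof (cases "coeff X i = 0 \<or> coeff Y j = 0")
    case False
    then have nz: "coeff X i \<noteq> 0" "coeff Y j \<noteq> 0" by auto
    have "weight Q X i + weight Q Y j < ?T"
    proof (cases "i > a")
      case True
      then show ?thesis using a(3)[OF nz(1)] b(2)[OF nz(2)] by simp
    next
      case False
      then have "j > b" using that by simp
      then show ?thesis using b(3)[OF nz(2)] a(2)[OF nz(1)] by simp
    qed
    moreover have "int i * ?\<delta> + int j * ?\<delta> = int (a + b) * ?\<delta>"
      unfolding that(1)[symmetric] by (simp add: algebra_simps)
    ultimately show ?thesis using mod_carries_value[OF X(1) nz(1) X(2) Y(1) nz(2) Y(2)]
      by (auto simp: L_def weight_def vle_def)
  qed (auto simp: L_def vle_def)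
  have small_div: "vle (poly (L i j div Q) y) (?T - int (a + b) * ?\<delta> - 1)"
    if "Suc (i + j) = a + b" for i j
  proof (cases "coeff X i = 0 \<or> coeff Y j = 0")
    case False
    then have nz: "coeff X i \<noteq> 0" "coeff Y j \<noteq> 0" by auto
    have "weight Q X i + weight Q Y j \<le> ?T" using a(2)[OF nz(1)] b(2)[OF nz(2)] by simp
    moreover have "int i * ?\<delta> + int j * ?\<delta> + ?\<delta> = int (a + b) * ?\<delta>"
      unfolding that(1)[symmetric] by (simp add: algebra_simps)
    ultimately show ?thesis using mod_carries_value[OF X(1) nz(1) X(2) Y(1) nz(2) Y(2)]
      by (auto simp: L_def weight_def vle_def)
  qed (auto simp: L_def vle_def)
  let ?rest = "(\<Sum>i\<in>{..a+b}-{a}. poly (L i (a + b - i) mod Q) y) +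
    (if a + b = 0 then 0 else \<Sum>i\<le>a+b-1. poly (L i (a + b - 1 - i) div Q) y)"
  have "poly (coeff Z (a + b)) y = poly (L a b mod Q) y + ?rest"
    unfolding coeffZ coeffF sum_mod_poly sum_div_poly
    by (simp add: poly_sum sum.remove[of "{..a+b}" a])
  moreover have "vle ?rest (?T - int (a + b) * ?\<delta> - 1)"
  proof (intro vle_add vle_sum)
    fix i assume "i \<in> {..a+b} - {a}"
    then show "vle (poly (L i (a + b - i) mod Q) y) (?T - int (a + b) * ?\<delta> - 1)"
      by (intro small_mod) auto
  next
    show "vle (if a + b = 0 then 0 else \<Sum>i\<le>a+b-1. poly (L i (a + b - 1 - i) div Q) y)
      (?T - int (a + b) * ?\<delta> - 1)"
    proof (cases "a + b = 0")
      case False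
      then have "vle (\<Sum>i\<le>a+b-1. poly (L i (a + b - 1 - i) div Q) y) (?T - int (a + b) * ?\<delta> - 1)"
        by (intro vle_sum small_div) auto
      then show ?thesis using False by (simp only: if_False)
    qed (simp only: if_True vle_def simp_thms)
  qed
  ultimately have "poly (coeff Z (a + b)) y \<noteq> 0" "v (poly (coeff Z (a + b)) y) = ?T - int (a + b) * ?\<delta>"
    using v_add_dominated[OF main(1), of ?rest] main(2) by auto
  then show ?thesis by (auto simp: weight_def)
qed

text \<open>Scale \<open>Q ^ M\<close> by an element of \<open>K\<close> to value zero and take an integral equation for its value at
  \<open>y\<close>. Undoing the scaling turns it into a monic polynomial \<open>G\<close> in \<open>Q\<close> that vanishes at \<open>y\<close> and
  all of whose weights are at most that of its top term. Now \<open>G = P * B\<close>, the maximal weight of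
  \<open>B\<close> is at least that of the top term of \<open>B\<close>, and the sum of the two maximal weights occurs in \<open>G\<close>,
  so the maximal weight of \<open>P\<close> is at most
  that of its top term \<open>Q ^ D\<close>.\<close>

lemma slope_bound:
  assumes E: "P = poly E Q" "\<And>j. over K (coeff E j)" "\<And>j. degree (coeff E j) < r"
    and D: "N = D * r" and nz: "coeff E j \<noteq> 0"
  shows "weight Q E j \<le> int D * v (poly Q y)"
proof -
  let ?\<delta> = "v (poly Q y)" and ?M = "nat M"
  have M: "int ?M = M" "?M > 0" using M_pos by auto
  obtain c where c: "c \<in> K" "c \<noteq> 0" "v c = M * (- ?\<delta>)" using K_value_exists by blast
  define h where "h = [:c:] * Q ^ ?M"
  have "over K h" unfolding h_def using c(1) Qf(4)
    by (intro over_closed(6)[OF K] over_power[OF K]) (auto simp: over_pCons over_closed[OF K])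
  moreover have hy: "poly h y = c * poly Q y ^ ?M" by (simp add: h_def)
  moreover have "poly h y \<noteq> 0" "v (poly h y) = 0"
    unfolding hy using c Qf(6) M by (simp_all add: v_mult v_power)
  ultimately obtain C where C: "over K C" "\<And>i. vle (coeff C i) 0" "lead_coeff C = 1"
    "poly C (c * poly Q y ^ ?M) = 0"
    using integral[of h] by metis
  define s where "s = degree C"
  define e where "e = (\<lambda>i. coeff C i * c ^ i * inverse (c ^ s))"
  \<comment> \<open>The expansion of \<open>G\<close> in powers of \<open>Q\<close>, with constant digits.\<close>
  define X where "X = (\<Sum>i\<le>s. monom [:e i:] (?M * i))"
  have coeffX: "coeff X (?M * i) = (if i \<le> s then [:e i:] else 0)" for i
    using M(2) by (simp add: X_def coeff_sum if_distrib cong: if_cong)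
  have coeffX': "coeff X k = 0" if "\<And>i. k \<noteq> ?M * i" for k
  proof -
    have "coeff (monom [:e i:] (?M * i)) k = 0" for i using that[of i, symmetric] by (simp only: coeff_monom if_False)
    then show ?thesis unfolding X_def coeff_sum by (intro sum.neutral) blast
  qed
  have coeffX_cases: "coeff X k = 0 \<or> (\<exists>i\<le>s. k = ?M * i \<and> coeff X k = [:e i:])" for k
    using coeffX coeffX' by metis
  have eK: "e i \<in> K" for i unfolding e_def using C(1) c(1)
    by (intro subring_closed(6)[OF K] subring_power[OF K] K_inverse) (auto simp: over_def)
  have X_over: "over K (coeff X k)" "degree (coeff X k) < r" for k
    using coeffX_cases[of k] eK levelD(1)[OF level] by (auto simp: over_pCons over_closed[OF K])
  have es: "e s = 1" using C(3) c(2) by (simp add: e_def s_def)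
  have X_bound: "weight Q X k \<le> int (s * ?M) * ?\<delta>" if nzk: "coeff X k \<noteq> 0" for k
  proof -
    obtain i where i: "i \<le> s" "k = ?M * i" "coeff X k = [:e i:]" using coeffX_cases[of k] nzk by blast
    then have ci: "coeff C i \<noteq> 0" using nzk by (auto simp: e_def)
    then have "v (e i) = v (coeff C i) + int i * v c - int s * v c"
      using c(2) by (simp add: e_def v_mult v_power v_inverse)
    moreover have "v (coeff C i) \<le> 0" using C(2)[of i] ci by (auto simp: vle_def)
    ultimately have "v (e i) \<le> int (s * ?M) * ?\<delta> - int k * ?\<delta>"
      using i(2) M(1) c(3) by (simp add: algebra_simps)
    then show ?thesis using i(3) by (simp add: weight_def)
  qed
  have dX: "degree X = ?M * s"
  proof (rule antisym)
    have "coeff X k = 0" if "?M * s < k" for k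
      using coeffX_cases[of k] that by (metis mult_le_mono2 not_le)
    then show "degree X \<le> ?M * s" by (intro degree_le) blast
    show "?M * s \<le> degree X" using coeffX[of s] es by (intro le_degree) simp
  qed
  have X0: "X \<noteq> 0" using coeffX[of s] es by auto
  define G where "G = poly X Q"
  have G: "over K G" unfolding G_def
    using X_over(1) Qf(4) unfolding poly_altdef
    by (intro over_sum[OF K] over_closed(6)[OF K] over_power[OF K])
  have lX: "lead_coeff X = 1" using dX coeffX[of s] es by (simp add: one_pCons)
  have Gdeg: "degree G = r * (?M * s)" "lead_coeff G = 1"
    using lead_coeff_expansion[of Q X] Qf X_over(2) X0 lX dX unfolding G_def by auto
  have "poly G y = inverse (c ^ s) * poly C (c * poly Q y ^ ?M)"
    unfolding G_def X_def poly_sum poly_monom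
    by (simp add: poly_altdef[of C] e_def s_def sum_distrib_left power_mult_distrib algebra_simps flip: power_mult)
  then have Gy: "poly G y = 0" using C(4) by simp
  have P0: "P \<noteq> 0" using P_monic by auto
  have "P dvd G"
  proof -
    have "over K (G mod P)" using over_divmod[OF K P_over P_monic G] by simp
    moreover have "poly (G mod P) y = 0"
      using Gy P_root by (metis div_mult_mod_eq poly_add poly_mult mult_zero_right add_0)
    moreover have "degree (G mod P) < N \<or> G mod P = 0" using degree_mod_less[OF P0, of G] by auto
    ultimately have "G mod P = 0" using P_minimal by blast
    then show ?thesis by auto
  qed
  then obtain B where B: "G = P * B" by blast
  have B_over: "over K B"
    using over_divmod[OF K P_over P_monic G] P0 B by simp
  have B0: "B \<noteq> 0" using B Gdeg(2) by auto
  have lB: "lead_coeff B = 1" using B Gdeg(2) P_monic by (simp add: lead_coeff_mult)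
  have dB: "degree B + D * r = r * (?M * s)" using B Gdeg(1) B0 P0 D by (simp add: degree_mult_eq)
  obtain Y where Y: "B = poly Y Q" "\<And>j. over K (coeff Y j)" "\<And>j. degree (coeff Y j) < r"
    using expansion_exists[OF K Qf(4,1,2) B_over] unfolding Qf(3) by blast
  have Y0: "Y \<noteq> 0" using B0 Y(1) by auto
  have Yl: "degree B = degree (lead_coeff Y) + r * degree Y" "lead_coeff (lead_coeff Y) = 1"
    using lead_coeff_expansion[of Q Y] Qf Y Y0 lB by auto
  \<comment> \<open>Only the top term of the expansion of \<open>B\<close> matters, and it is \<open>Q ^ (?M * s - D)\<close>.\<close>
  have dY: "degree Y + D = ?M * s \<and> degree (lead_coeff Y) = 0"
  proof -
    have "degree (lead_coeff Y) + r * (degree Y + D) = r * (?M * s)" using dB Yl(1) by (simp add: algebra_simps)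
    moreover from this have "degree (lead_coeff Y) = 0"
      using Y(3)[of "degree Y"] by (metis dvd_add_left_iff dvd_triv_left nat_dvd_not_less not_gr0)
    ultimately show ?thesis using levelD(1)[OF level] by simp
  qed
  have Ytop: "lead_coeff Y = 1" using dY Yl(2) by (auto elim!: degree_eq_zeroE simp: one_pCons)
  have E0: "E \<noteq> 0" using nz by auto
  obtain a where a: "coeff E a \<noteq> 0" "\<And>j. coeff E j \<noteq> 0 \<Longrightarrow> weight Q E j \<le> weight Q E a"
    "\<And>j. coeff E j \<noteq> 0 \<Longrightarrow> j > a \<Longrightarrow> weight Q E j < weight Q E a"
    using top_index_exists[OF E0] by metis
  obtain b where b: "coeff Y b \<noteq> 0" "\<And>j. coeff Y j \<noteq> 0 \<Longrightarrow> weight Q Y j \<le> weight Q Y b"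
    "\<And>j. coeff Y j \<noteq> 0 \<Longrightarrow> j > b \<Longrightarrow> weight Q Y j < weight Q Y b"
    using top_index_exists[OF Y0] by metis
  have "coeff X (a + b) \<noteq> 0 \<and> weight Q X (a + b) = weight Q E a + weight Q Y b"
    by (rule weight_product) (use E Y X_over a b B in \<open>auto simp: G_def\<close>)
  then have "weight Q E a + weight Q Y b \<le> int (s * ?M) * ?\<delta>" using X_bound by metis
  moreover have "weight Q Y (degree Y) = int (degree Y) * ?\<delta>"
    using Ytop by (simp add: weight_def v_one)
  moreover have "weight Q Y (degree Y) \<le> weight Q Y b" using b(2) Y0 by simp
  moreover have "int (s * ?M) * ?\<delta> = int (degree Y) * ?\<delta> + int D * ?\<delta>"
    using dY by (metis distrib_right mult.commute of_nat_add)
  ultimately show ?thesis using a(2)[OF nz] by linarith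
qed

end
end

section \<open>Approximate roots\<close>

lemma degree_diff_monic:
  fixes p q :: "'l::field poly"
  assumes "degree p = n" "degree q = n" "lead_coeff p = 1" "lead_coeff q = 1" "n > 0"
  shows "degree (p - q) < n"
proof (intro degree_lessI allI impI)
  fix k assume "k \<ge> n"
  then show "coeff (p - q) k = 0" using assms by (cases "k = n") (auto simp: coeff_eq_0)
qed (use assms in auto)

text \<open>The coefficients of \<open>H\<close> are found one after the other from the top: at each step the top coefficient of
  \<open>P - H ^ Suc d\<close> is removed by a correction that enters linearly with the factor \<open>Suc d\<close>, and the
  higher order terms are of lower degree.\<close>

lemma approximate_root_exists:
  fixes P :: "'l::field poly"
  assumes S: "is_subring S" and P: "over S P" "lead_coeff P = 1" "degree P = Suc d * r"
    and d: "d > 0" and r: "r > 0" and a: "a \<in> S" "a * of_nat (Suc d) = 1"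
  obtains H where "over S H" "lead_coeff H = 1" "degree H = r" "degree (P - H ^ Suc d) < d * r"
proof -
  have "\<exists>H. over S H \<and> lead_coeff H = 1 \<and> degree H = r \<and> degree (P - H ^ Suc d) < Suc d * r - i"
    if "i \<le> r" for i
    using that
  proof (induction i)
    case 0
    let ?H = "monom 1 r :: 'l poly"
    have H: "over S ?H" "lead_coeff ?H = 1" "degree ?H = r"
      by (auto simp: over_monom[OF S] subring_closed[OF S] degree_monom_eq)
    moreover have "degree (P - ?H ^ Suc d) < Suc d * r"
    proof -
      have "?H ^ Suc d = monom 1 (Suc d * r)" by (simp only: monom_power power_one mult.commute)
      then show ?thesis using r P by (intro degree_diff_monic) (simp_all add: degree_monom_eq del: power_Suc)
    qed
    ultimately show ?case by (intro exI[of _ ?H]) simp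
  next
    case (Suc i)
    then obtain H where H: "over S H" "lead_coeff H = 1" "degree H = r" "degree (P - H ^ Suc d) < Suc d * r - i"
      by auto
    define m where "m = Suc d * r - Suc i"
    define k where "k = r - Suc i"
    have ir: "i < r" using Suc.prems by simp
    have mk: "m = d * r + k" "Suc d * r - i = Suc m" using ir by (auto simp: m_def k_def)
    have mpos: "m > 0" using d r mk by simp
    define c where "c = coeff (P - H ^ Suc d) m"
    define b where "b = monom (a * c) k"
    have c: "c \<in> S" unfolding c_def using H(1) P(1) over_closed(3)[OF S] over_power[OF S] unfolding over_def by blast
    have b: "degree b \<le> k" "degree b < degree H" "over S b"
      using degree_monom_le[of "a * c" k] ir H(3) c a unfolding b_def k_def
      by (auto intro!: over_monom[OF S] subring_closed(6)[OF S])
    obtain R where R: "(H + b) ^ Suc d = H ^ Suc d + of_nat (Suc d) * b * H ^ d + b\<^sup>2 * R"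
      "R = 0 \<or> degree R + degree H \<le> d * degree H"
      using first_order_power[OF b(2)] by blast
    have "of_nat (Suc d) * b = monom c k"
    proof -
      have "of_nat (Suc d) * b = monom (of_nat (Suc d) * (a * c)) k"
        unfolding b_def of_nat_poly by (simp add: smult_monom del: of_nat_Suc)
      also have "of_nat (Suc d) * (a * c) = c" using a(2) by (metis mult.assoc mult.commute mult.left_neutral)
      finally show ?thesis .
    qed
    then have diff: "P - (H + b) ^ Suc d = (P - H ^ Suc d) - monom c k * H ^ d - b\<^sup>2 * R"
      unfolding R(1) by simp
    have dH: "degree (H ^ d) = d * r" "coeff (H ^ d) (d * r) = 1"
    proof -
      have "H \<noteq> 0" using H(2) by auto
      then show "degree (H ^ d) = d * r" using H(3) by (simp add: degree_power_eq)
      then show "coeff (H ^ d) (d * r) = 1" using H(2) lead_coeff_power[of H d] by simp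
    qed
    have dR: "b\<^sup>2 * R = 0 \<or> degree (b\<^sup>2 * R) < m"
    proof (cases "b\<^sup>2 * R = 0")
      case False
      then have "degree (b\<^sup>2 * R) = 2 * degree b + degree R" by (simp add: degree_mult_eq degree_power_eq)
      moreover have "degree R + r \<le> d * r" using R(2) False H(3) by auto
      ultimately show ?thesis using b H(3) mk by linarith
    qed simp
    have "coeff (P - (H + b) ^ Suc d) j = 0" if "j \<ge> m" for j
    proof -
      have 1: "coeff (b\<^sup>2 * R) j = 0" using dR that by (auto intro: coeff_eq_0)
      show ?thesis
      proof (cases "j = m")
        case True
        have "coeff (monom c k * H ^ d) m = c" using dH mk by (simp add: coeff_monom_mult)
        then show ?thesis using 1 unfolding diff coeff_diff True c_def by simp
      next
        case False
        have "coeff (P - H ^ Suc d) j = 0" using H(4) that False mk(2) by (intro coeff_eq_0) simp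
        moreover have "coeff (monom c k * H ^ d) j = 0"
          using dH(1) mk that False by (auto simp: coeff_monom_mult intro!: coeff_eq_0)
        ultimately show ?thesis using 1 unfolding diff coeff_diff by simp
      qed
    qed
    then have "degree (P - (H + b) ^ Suc d) < m" using mpos by (intro degree_lessI) auto
    moreover have "degree (H + b) = r" using b(2) H(3) by (simp add: degree_add_eq_left)
    moreover from this have "lead_coeff (H + b) = 1" using b(2) H(2,3) by (simp add: coeff_eq_0)
    ultimately show ?case using over_closed(4)[OF S H(1) b(3)] unfolding m_def by blast
  qed
  from this[of r] show thesis using that by auto
qed

text \<open>\<open>A\<close> will be \<open>k[f]\<close>. The last assumption holds because elements of \<open>k[f,g]\<close> are polynomials in \<open>z\<close>.\<close>

locale polynomial_curve = one_place +
  fixes A :: "'a set"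
  assumes A: "is_subring A" and A_K: "A \<subseteq> K" and P_over_A: "over A P"
    and A_of_nat: "D > 0 \<Longrightarrow> \<exists>a\<in>A. a * of_nat D = 1"
    and value_nonneg: "over A h \<Longrightarrow> poly h y \<noteq> 0 \<Longrightarrow> v (poly h y) \<ge> 0"
begin

lemma A_value_nonneg: "a \<in> A \<Longrightarrow> a \<noteq> 0 \<Longrightarrow> v a \<ge> 0"
  using value_nonneg[of "[:a:]"] by (auto simp: over_pCons over_closed[OF A])

text \<open>Positive integers are units of \<open>A\<close>, so their values are zero.\<close>

lemma inverse_of_nat:
  assumes "D > 0"
  obtains a where "a \<in> A" "a * of_nat D = 1" "v a = 0"
proof -
  obtain a where a: "a \<in> A" "a * of_nat D = 1" using A_of_nat[OF assms] by blast
  then have nz: "a \<noteq> 0" "of_nat D \<noteq> (0::'a)" by auto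
  then have "v a + v (of_nat D) = 0" using a(2) v_mult[OF nz] v_one by simp
  moreover have "v a \<ge> 0" "v (of_nat D) \<ge> 0"
    using A_value_nonneg nz a(1) subring_of_nat[OF A] by auto
  ultimately show thesis using that a by simp
qed

context
  fixes r :: nat and d :: int and D :: nat and H :: "'a poly"
  assumes level: "level r d" and rN: "r < N" and D: "N = Suc D * r"
    and H: "over K H" "lead_coeff H = 1" "degree H = r" "degree (P - H ^ Suc D) < D * r"
begin

text \<open>The Tschirnhausen step. With \<open>b = H - Q\<close>, comparing \<open>P = (Q + b) ^ Suc D + \<dots>\<close> with the expansion of
  \<open>P\<close> in powers of \<open>Q\<close> shows that the digit \<open>a\<close> of \<open>Q ^ D\<close> agrees with \<open>Suc D * b\<close> up to terms of degree
  below that of \<open>b\<close>. Hence \<open>Q + a / Suc D\<close> is closer to \<open>H\<close>, and it is optimal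
  since \<open>slope_bound\<close> bounds the value of \<open>a\<close> by that of \<open>Q\<close>.\<close>

lemma approximate_root_closer:
  assumes Q: "opt r Q" "Q \<noteq> H"
  shows "\<exists>Q'. opt r Q' \<and> (Q' = H \<or> degree (H - Q') < degree (H - Q))"
proof -
  note Qf = Q_facts[OF level rN Q(1)]
  define b where "b = H - Q"
  have b: "degree b < degree Q" "b \<noteq> 0" "H = Q + b" "over K b"
    using degree_diff_monic[of H r Q] H Qf Q(2) over_closed(3)[OF K H(1) Qf(4)] by (auto simp: b_def)
  obtain R where R: "(Q + b) ^ Suc D = Q ^ Suc D + of_nat (Suc D) * b * Q ^ D + b\<^sup>2 * R"
    "R = 0 \<or> degree R + degree Q \<le> D * degree Q"
    using first_order_power[OF b(1)] by blast
  obtain E where E: "P = poly E Q" "\<And>j. over K (coeff E j)" "\<And>j. degree (coeff E j) < r"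
    using expansion_exists[OF K Qf(4,1,2) P_over] unfolding Qf(3) by blast
  have E0: "E \<noteq> 0" using E(1) P_monic by auto
  have El: "N = degree (lead_coeff E) + r * degree E" "lead_coeff (lead_coeff E) = 1"
    using lead_coeff_expansion[of Q E] Qf E E0 P_monic by auto
  have dE: "degree E = Suc D \<and> degree (lead_coeff E) = 0"
  proof -
    have "degree (lead_coeff E) + r * degree E = r * Suc D" using El(1) D by (simp add: algebra_simps)
    moreover from this have "degree (lead_coeff E) = 0"
      using E(3)[of "degree E"] by (metis dvd_add_left_iff dvd_triv_left nat_dvd_not_less not_gr0)
    ultimately have "r * degree E = r * Suc D" by (simp only: add_0)
    then have "degree E = Suc D" using levelD(1)[OF level] mult_left_cancel[of r] by blast
    then show ?thesis using \<open>degree (lead_coeff E) = 0\<close> by blast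
  qed
  then have Etop: "coeff E (Suc D) = 1" using El(2) by (auto elim!: degree_eq_zeroE simp: one_pCons)
  define a where "a = coeff E D"
  have a: "over K a" "degree a < r" "vle (poly a y) (v (poly Q y))"
  proof -
    show "over K a" "degree a < r" using E by (auto simp: a_def)
    show "vle (poly a y) (v (poly Q y))"
      using slope_bound[OF level rN Q(1) E D, of D]
      by (cases "a = 0") (auto simp: a_def vle_def weight_def algebra_simps)
  qed
  have Dpos: "D > 0" using D rN by (cases D) auto
  define L where "L = (\<Sum>j<D. coeff E j * Q ^ j)"
  have P_eq: "P = L + a * Q ^ D + Q ^ Suc D"
    unfolding E(1) poly_altdef dE[THEN conjunct1] L_def a_def
    by (simp add: Etop lessThan_Suc_atMost[symmetric] del: power_Suc)
  have dr: "D * r > 0" using Dpos levelD(1)[OF level] by simp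
  have dL: "degree L < D * r"
    unfolding L_def
  proof (intro degree_lessI allI impI)
    fix k assume k: "k \<ge> D * r"
    have "coeff (coeff E j * Q ^ j) k = 0" if "j < D" for j
    proof (rule coeff_eq_0)
      have "degree (coeff E j * Q ^ j) \<le> degree (coeff E j) + degree (Q ^ j)" by (rule degree_mult_le)
      also have "\<dots> < Suc j * r" using E(3)[of j] Qf by (simp add: degree_power_eq)
      also have "\<dots> \<le> D * r" using that by (intro mult_right_mono) auto
      finally show "degree (coeff E j * Q ^ j) < k" using k by simp
    qed
    then show "coeff (\<Sum>j<D. coeff E j * Q ^ j) k = 0" unfolding coeff_sum by (intro sum.neutral) simp
  qed (use dr in simp)
  define e where "e = of_nat (Suc D) * b - a"
  have "e * Q ^ D = L - (P - H ^ Suc D) - b\<^sup>2 * R"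
    unfolding e_def b(3) R(1) P_eq by (simp add: algebra_simps del: power_Suc of_nat_Suc)
  moreover have "degree (L - (P - H ^ Suc D) - b\<^sup>2 * R) < degree b + D * r"
  proof -
    have "b\<^sup>2 * R = 0 \<or> degree (b\<^sup>2 * R) < degree b + D * r"
    proof (cases "b\<^sup>2 * R = 0")
      case False
      then have "degree (b\<^sup>2 * R) = 2 * degree b + degree R" by (simp add: degree_mult_eq degree_power_eq)
      moreover have "degree R + r \<le> D * r" using R(2) False Qf(3) by auto
      ultimately show ?thesis using b Qf(3) by linarith
    qed simp
    then have "degree (b\<^sup>2 * R) < degree b + D * r" using dr by auto
    moreover have "degree (L - (P - H ^ Suc D)) < degree b + D * r"
      by (rule degree_diff_less) (use dL H(4) in linarith)+
    ultimately show ?thesis by (rule degree_diff_less[rotated])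
  qed
  ultimately have "degree (e * Q ^ D) < degree b + D * r" by (simp only:)
  then have e_deg: "e = 0 \<or> degree e < degree b"
    using Qf by (cases "e = 0") (simp_all add: degree_mult_eq degree_power_eq)
  obtain t where t: "t \<in> A" "t * of_nat (Suc D) = 1" "v t = 0" using inverse_of_nat[of "Suc D"] by auto
  have t0: "t \<noteq> 0" using t(2) by auto
  define q where "q = [:t:] * a"
  have "opt r (Q + q)"
  proof (rule opt_add_lower[OF Q(1)])
    show "over K q" unfolding q_def using t(1) A_K a(1)
      by (intro over_closed(6)[OF K]) (auto simp: over_pCons over_closed[OF K])
    show "degree q < r" using a(2) t0 unfolding q_def by simp
    have "vle t 0" using t(3) by (simp add: vle_def)
    from vle_mult[OF this a(3)] show "vle (poly q y) (v (poly Q y))" unfolding q_def by simp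
  qed
  moreover have "H - (Q + q) = [:t:] * e"
  proof -
    have "[:t:] * of_nat (Suc D) = (1 :: 'a poly)"
      unfolding of_nat_poly using t(2) by (simp add: one_pCons mult.commute del: of_nat_Suc)
    then have "[:t:] * (of_nat (Suc D) * b) = b" by (metis mult.assoc mult.left_neutral)
    then show ?thesis unfolding e_def q_def b_def by (simp only: right_diff_distrib) (simp add: algebra_simps)
  qed
  ultimately show ?thesis using e_deg t0 unfolding b_def
    by (intro exI[of _ "Q + q"]) auto
qed

lemma approximate_root_opt: "opt r Q \<Longrightarrow> opt r H"
proof (induction "degree (H - Q)" arbitrary: Q rule: less_induct)
  case less
  show ?case
  proof (cases "Q = H")
    case False
    then show ?thesis using approximate_root_closer[OF less.prems] less.hyps by blast
  qed (use less.prems in simp)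
qed

end

text \<open>A level divides \<open>N\<close>, so \<open>P\<close> has an approximate root of that degree, and it inherits optimality from any optimal polynomial over \<open>K\<close>.\<close>

lemma opt_over_A_exists:
  assumes level: "level r d" and rN: "r < N"
  obtains H where "over A H" "opt r H"
proof -
  obtain k where k: "N = r * k" using level_dvd[OF level] by blast
  then have "k > 1" using rN by (metis less_one linorder_neqE_nat mult.right_neutral mult_0_right not_less_zero less_irrefl)
  then obtain D where D: "N = Suc D * r" "D > 0"
    using k by (metis Suc_lessE mult.commute One_nat_def)
  obtain t where t: "t \<in> A" "t * of_nat (Suc D) = 1" using A_of_nat[of "Suc D"] by auto
  obtain H where H: "over A H" "lead_coeff H = 1" "degree H = r" "degree (P - H ^ Suc D) < D * r"
    using approximate_root_exists[OF A P_over_A P_monic D levelD(1)[OF level] t] by blast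
  obtain Q where "opt r Q" using opt_exists[OF rN] by blast
  then have "opt r H" using approximate_root_opt[OF level rN D(1) over_mono[OF H(1) A_K] H(2-4)] by blast
  then show thesis using that H(1) by blast
qed

end

section \<open>Degrees of the elements of the coordinate ring\<close>

context polynomial_curve
begin

context
  assumes y_nonzero: "y \<noteq> 0" and not_dvd: "\<not> M dvd v y"
begin

lemma N_gt_1: "N > 1"
proof (rule ccontr)
  assume "\<not> N > 1"
  then have N1: "N = 1" using N_pos by simp
  then have "y = - coeff P 0"
    using P_root P_monic by (simp add: poly_altdef eq_neg_iff_add_eq_0 add.commute)
  then have "y \<in> K" using P_over subring_closed(5)[OF K] by (simp add: over_def)
  then show False using K_value y_nonzero not_dvd by blast
qed

lemma opt_X: "opt 1 [:0, 1:]"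
proof -
  have "\<not> M dvd v y - v a" if "a \<in> K" "a \<noteq> 0" for a
    using K_value[OF that] not_dvd by (metis dvd_add diff_add_cancel)
  then show ?thesis using y_nonzero unfolding opt_def
    by (auto simp: over_pCons subring_closed[OF K] over_closed[OF K] elim!: degree_eq_zeroE)
qed

abbreviation block :: nat where "block \<equiv> ram_index M [:0, 1:]"

text \<open>The part of the structure of optimal polynomials that the theorem depends on: they come in blocks
  of length \<open>block\<close> in which each is \<open>y\<close> times its predecessor.\<close>

definition blockwise :: "nat \<Rightarrow> bool" where
  "blockwise r \<longleftrightarrow> block dvd r \<and>
    (\<forall>s<r. block dvd s \<longrightarrow> (\<exists>h. over A h \<and> (\<forall>j<block. opt (s + j) ([:0, 1:] ^ j * h))))"

lemma blockwise_first: "blockwise block"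
  unfolding blockwise_def
proof (intro conjI allI impI)
  fix s assume "s < block" "block dvd s"
  then have "s = 0" by auto
  moreover have "opt (j * 1 + 0) ([:0, 1:] ^ j * 1)" if "j < block" for j
    using opt_mult_power[OF level_one N_gt_1 opt_X opt_one _ that] by simp
  ultimately show "\<exists>h. over A h \<and> (\<forall>j<block. opt (s + j) ([:0, 1:] ^ j * h))"
    by (intro exI[of _ 1]) (auto simp: over_closed[OF A])
qed simp

lemma blockwise_step:
  assumes level: "level r d" and rN: "r < N" and Q: "opt r Q" "over A Q" and b: "blockwise r"
  shows "blockwise (r * ram_index d Q)"
  unfolding blockwise_def
proof (intro conjI allI impI)
  show "block dvd r * ram_index d Q" using b by (simp add: blockwise_def)
  fix s assume s: "s < r * ram_index d Q" "block dvd s"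
  define i s' where "i = s div r" and "s' = s mod r"
  have r: "r > 0" "block dvd r" using levelD(1)[OF level] b by (auto simp: blockwise_def)
  have i: "i < ram_index d Q" using s(1) r by (simp add: i_def less_mult_imp_div_less mult.commute)
  have s': "s' < r" "block dvd s'" using r s(2) by (auto simp: s'_def dvd_mod)
  have s_eq: "s = i * r + s'" by (simp add: i_def s'_def)
  obtain h where h: "over A h" "\<And>j. j < block \<Longrightarrow> opt (s' + j) ([:0, 1:] ^ j * h)"
    using b s' unfolding blockwise_def by blast
  have "opt (s + j) ([:0, 1:] ^ j * (Q ^ i * h))" if j: "j < block" for j
  proof -
    have "s' + j < r"
    proof -
      obtain k l where kl: "s' = block * k" "r = block * l" using s'(2) r(2) by blast
      then have "k < l" using s'(1) by simp
      then have "block * Suc k \<le> block * l" by (intro mult_le_mono) auto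
      then show ?thesis using kl j by simp
    qed
    then have "opt (i * r + (s' + j)) (Q ^ i * ([:0, 1:] ^ j * h))"
      using opt_mult_power[OF level rN Q(1) h(2)[OF j] _ i] by simp
    then show ?thesis unfolding s_eq by (simp only: ac_simps)
  qed
  moreover have "over A (Q ^ i * h)" using Q(2) h(1) by (intro over_closed(6)[OF A] over_power[OF A])
  ultimately show "\<exists>h. over A h \<and> (\<forall>j<block. opt (s + j) ([:0, 1:] ^ j * h))" by blast
qed

lemma blockwise_all: "level r d \<Longrightarrow> blockwise r \<Longrightarrow> blockwise N"
proof (induction "N - r" arbitrary: r d rule: less_induct)
  case less
  show ?case
  proof (cases "r < N")
    case True
    then obtain Q where Q: "over A Q" "opt r Q" using opt_over_A_exists[OF less.prems(1)] by blast
    note step = level_step[OF less.prems(1) True Q(2)]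
    have lt: "r < r * ram_index d Q"
      using ram_index_ge_2[OF less.prems(1) True Q(2)] levelD(1)[OF less.prems(1)] by simp
    then show ?thesis
      by (intro less.hyps[OF _ step blockwise_step[OF less.prems(1) True Q(2,1) less.prems(2)]]
          diff_less_mono2 lt True)
  qed (use levelD(2)[OF less.prems(1)] less.prems(2) in auto)
qed

lemma blockwise_N: "blockwise N"
  using blockwise_all[OF level_step[OF level_one N_gt_1 opt_X]] blockwise_first by simp

text \<open>If \<open>e s\<close> denotes the value of the optimal polynomial of degree \<open>s\<close>, every value of an element of \<open>A[y]\<close> is
  \<open>e s\<close> plus a nonnegative multiple of \<open>M\<close>. Let \<open>s\<close> and \<open>t\<close> belong to \<open>U\<close> and \<open>W\<close>. Adding \<open>v y\<close> to the
  value of \<open>U\<close> and \<open>M\<close> to that of \<open>W\<close> gives the same number; if \<open>s\<close> is not the end of a block, this forces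
  \<open>t = s + 1\<close> and makes the value of \<open>W\<close> at least \<open>v y\<close>. At the end of a block \<open>e s\<close> is already larger than \<open>M\<close>.\<close>

lemma no_common_shift:
  assumes U: "over A U" "poly U y \<noteq> 0" and W: "over A W" "poly W y \<noteq> 0"
    and n: "0 < v y" "v y < M" "\<not> v y dvd M"
    and c: "c > 0" "v (poly U y) = M - c" "v (poly W y) = v y - c"
  shows False
proof -
  have block: "block \<ge> 2" "int block * gcd M (v y) = M"
    using ram_index_ge_2[OF level_one N_gt_1 opt_X] ram_index_times_gcd[OF level_one N_gt_1 opt_X] by auto
  have blocks: "block dvd N" "\<exists>h. over A h \<and> (\<forall>j<block. opt (s + j) ([:0, 1:] ^ j * h))" if "s < N" "block dvd s" for s
    using blockwise_N that unfolding blockwise_def by auto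
  have n1N: "block dvd N" using blockwise_N by (simp add: blockwise_def)
  obtain B where B: "\<And>s. s < N \<Longrightarrow> block dvd s \<Longrightarrow> over A (B s) \<and> (\<forall>j<block. opt (s + j) ([:0, 1:] ^ j * B s))"
    using blocks(2) by metis
  define H where "H = (\<lambda>s. [:0, 1:] ^ (s mod block) * B (s div block * block))"
  define e where "e = (\<lambda>s. v (poly (H s) y))"
  have X_A: "over A [:0, 1:]" by (auto simp: over_pCons subring_closed[OF A] over_closed[OF A])
  have H: "over A (H s)" "opt s (H s)" if "s < N" for s
  proof -
    have "s div block * block < N" using that by (meson div_times_less_eq_dividend le_less_trans)
    then have b: "over A (B (s div block * block))"
      "\<And>j. j < block \<Longrightarrow> opt (s div block * block + j) ([:0, 1:] ^ j * B (s div block * block))"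
      using B[of "s div block * block"] by auto
    have "s mod block < block" using block(1) by simp
    from b(1) b(2)[OF this] show "over A (H s)" "opt s (H s)"
      using X_A unfolding H_def by (auto intro!: over_closed(6)[OF A] over_power[OF A] simp del: mult_pCons_left)
  qed
  have e_nonneg: "e s \<ge> 0" if "s < N" for s
    unfolding e_def using value_nonneg H[OF that] optD(4) by blast
  have value_basis: "\<exists>s<N. \<exists>a\<ge>0. M dvd a \<and> v (poly V y) = a + e s" if V: "over A V" "poly V y \<noteq> 0" for V
  proof -
    have VA: "over A (V mod P)" using over_divmod[OF A P_over_A P_monic V(1)] by simp
    have Vy: "poly (V mod P) y = poly V y"
      using P_root by (metis div_mult_mod_eq poly_add poly_mult mult_zero_right add_0)
    have V0: "V mod P \<noteq> 0" using Vy V(2) by auto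
    have P0: "P \<noteq> 0" using P_monic by auto
    then have dV: "degree (V mod P) < N" using degree_mod_less[OF P0, of V] V0 by blast
    have "\<exists>s\<le>degree (V mod P). \<exists>a\<in>A. a \<noteq> 0 \<and> v (poly (V mod P) y) = v a + e s"
      using value_via_basis[OF A A_K _ VA V0 dV, of H] H unfolding e_def by blast
    then obtain s a where sa: "s \<le> degree (V mod P)" "a \<in> A" "a \<noteq> 0" "v (poly V y) = v a + e s"
      unfolding Vy by blast
    have "s < N" using sa(1) dV by linarith
    moreover have "v a \<ge> 0" "M dvd v a" using A_value_nonneg[OF sa(2,3)] K_value[of a] A_K sa(2,3) by auto
    ultimately show ?thesis using sa(4) by blast
  qed
  obtain s a where s: "s < N" "a \<ge> 0" "M dvd a" "M - c = a + e s" using value_basis[OF U] c(2) by auto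
  obtain t b where t: "t < N" "b \<ge> 0" "M dvd b" "v y - c = b + e t" using value_basis[OF W] c(3) by auto
  show False
  proof (cases "Suc (s mod block) = block")
    case False
    have "s mod block < block" using block(1) by simp
    then have sm: "Suc (s mod block) < block" using False by simp
    then have mod: "Suc s mod block = Suc (s mod block)" "Suc s div block = s div block"
      by (simp_all add: mod_Suc div_Suc)
    have "Suc s < N"
    proof (rule ccontr)
      assume "\<not> Suc s < N"
      then have "Suc s = N" using s(1) by simp
      then show False using n1N mod(1) by (metis dvd_imp_mod_0 nat.simps(3))
    qed
    have "H (Suc s) = [:0, 1:] * H s" unfolding H_def mod by (simp add: mult.assoc)
    then have eS: "e (Suc s) = v y + e s"
      using optD(4)[OF H(2)[OF s(1)]] y_nonzero unfolding e_def by (simp add: v_mult)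
    have "e (Suc s) - e t = M + (b - a)" using eS s(4) t(4) by simp
    then have "M dvd e (Suc s) - e t" using s(3) t(3) by simp
    then have "Suc s = t"
      using opt_distinct_values[OF H(2)[OF \<open>Suc s < N\<close>] H(2)[OF t(1)]] unfolding e_def by blast
    then show False using t(2,4) eS e_nonneg[OF s(1)] c(1) by simp
  next
    case True
    let ?s0 = "s div block * block"
    have s0: "?s0 < N" using s(1) by (meson div_times_less_eq_dividend le_less_trans)
    have h0: "e ?s0 \<ge> 0" "poly (H ?s0) y \<noteq> 0" using e_nonneg[OF s0] optD(4)[OF H(2)[OF s0]] by auto
    have "H s = [:0, 1:] ^ (s mod block) * H ?s0" unfolding H_def using block(1) by simp
    then have "e s = int (s mod block) * v y + e ?s0"
      using h0(2) y_nonzero unfolding e_def by (simp add: v_mult v_power poly_power)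
    moreover have "int (s mod block) = int block - 1" using True by simp
    ultimately have es: "e s \<ge> int block * v y - v y" using h0(1) by (simp add: left_diff_distrib)
    \<comment> \<open>Here \<open>int block * v y\<close> is the least common multiple of \<open>M\<close> and \<open>v y\<close>, which is a proper multiple of \<open>M\<close>.\<close>
    obtain k where k: "v y = gcd M (v y) * k" using gcd_dvd2 by blast
    have g: "gcd M (v y) > 0" using M_pos by simp
    have kM: "int block * v y = M * k" by (subst k) (metis block(2) mult.assoc)
    have "k > 0" using k g n(1) by (metis zero_less_mult_pos)
    moreover have "k \<noteq> 1" using k n(3) by (metis gcd_dvd1 mult.right_neutral)
    ultimately have "M * 2 \<le> M * k" using M_pos by (intro mult_left_mono) auto
    then show False using es kM s(2,4) n(2) c(1) by linarith
  qed
qed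

end
end

section \<open>Evaluation of polynomials in Laurent series\<close>

definition emb :: "'a::field fls \<Rightarrow> 'a poly \<Rightarrow> 'a fls" where
  "emb t p = poly (map_poly fls_const p) t"

lemma emb_pCons: "emb t (pCons a p) = fls_const a + t * emb t p"
  unfolding emb_def by (cases "a = 0 \<and> p = 0") (auto simp: map_poly_pCons)

lemma emb_0 [simp]: "emb t 0 = 0"
  by (simp add: emb_def)

lemma emb_const: "emb t [:a:] = fls_const a"
  by (simp add: emb_pCons)

lemma emb_1 [simp]: "emb t 1 = 1"
  using emb_const[of t 1] by (simp add: one_pCons)

lemma emb_add: "emb t (p + q) = emb t p + emb t q"
proof (induction p q rule: poly_induct2)
  case (pCons a p b q)
  have "fls_const (a + b) = fls_const a + fls_const b" by (intro fls_eqI) simp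
  then show ?case using pCons by (simp add: emb_pCons algebra_simps)
qed simp

lemma emb_minus: "emb t (- p) = - emb t p"
  using emb_add[of t p "- p"] by (simp add: eq_neg_iff_add_eq_0 add.commute)

lemma emb_diff: "emb t (p - q) = emb t p - emb t q"
  using emb_add[of t p "- q"] by (simp add: emb_minus)

lemma emb_smult: "emb t (Polynomial.smult a p) = fls_const a * emb t p"
  by (induction p) (auto simp: emb_pCons algebra_simps)

lemma emb_mult: "emb t (p * q) = emb t p * emb t q"
  by (induction p) (auto simp: emb_pCons emb_add emb_smult algebra_simps)

lemma emb_pcompose: "emb t (pcompose p q) = emb (emb t q) p"
  by (induction p) (auto simp: pcompose_pCons emb_add emb_mult emb_const emb_pCons)

lemma emb_sum: "emb t (\<Sum>i\<in>I. p i) = (\<Sum>i\<in>I. emb t (p i))"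
  by (induction I rule: infinite_finite_induct) (auto simp: emb_add)

lemma emb_altdef: "emb t p = (\<Sum>i\<le>degree p. fls_const (coeff p i) * t ^ i)"
proof -
  have m: "emb t (monom a i) = fls_const a * t ^ i" for a i
    by (induction i) (auto simp: monom_0 emb_const monom_Suc emb_pCons)
  have "emb t p = emb t (\<Sum>i\<le>degree p. monom (coeff p i) i)" by (simp only: poly_as_sum_of_monoms)
  then show ?thesis by (simp only: emb_sum m)
qed

lemma is_subring_emb: "is_subring (range (emb t))"
  unfolding is_subring_def
proof (intro conjI ballI)
  show "1 \<in> range (emb t)" by (rule image_eqI[of _ _ 1]) auto
  fix a b assume "a \<in> range (emb t)" "b \<in> range (emb t)"
  then obtain p q where "a = emb t p" "b = emb t q" by blast
  then show "a - b \<in> range (emb t)" "a * b \<in> range (emb t)"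
    by (simp_all flip: emb_diff emb_mult)
qed

text \<open>The order of the pole at infinity: the variable of the series stands for \<open>1/z\<close>, so this extends the degree in \<open>z\<close>.\<close>

definition deg_inf :: "'a::field fls \<Rightarrow> int" where
  "deg_inf h = - fls_subdegree h"

interpretation fls: valued_field "deg_inf :: 'a::field fls \<Rightarrow> int"
proof
  fix a b :: "'a fls" assume ab: "a \<noteq> 0" "b \<noteq> 0"
  then show "deg_inf (a * b) = deg_inf a + deg_inf b" by (simp add: deg_inf_def)
  assume "a + b \<noteq> 0"
  from fls_plus_subdegree[OF this] show "deg_inf (a + b) \<le> max (deg_inf a) (deg_inf b)"
    by (auto simp: deg_inf_def)
qed

abbreviation Z :: "'a::field fls" where "Z \<equiv> fls_X_inv"

lemma deg_inf_Z: "deg_inf (Z ^ i :: 'a::field fls) = int i"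
  by (simp add: deg_inf_def)

lemma Z_nonzero: "(Z ^ i :: 'a::field fls) \<noteq> 0"
  by simp

lemma deg_inf_emb: "p \<noteq> 0 \<Longrightarrow> emb Z p \<noteq> 0 \<and> deg_inf (emb Z p) = int (degree p)"
proof (induction p)
  case (pCons a p)
  show ?case
  proof (cases "p = 0")
    case True
    then show ?thesis using pCons by (simp add: emb_pCons deg_inf_def)
  next
    case False
    then have IH: "emb Z p \<noteq> 0" "deg_inf (emb Z p) = int (degree p)" using pCons by auto
    have "Z * emb Z p \<noteq> 0" "deg_inf (Z * emb Z p) = 1 + int (degree p)"
      using fls.v_mult[OF Z_nonzero[of 1] IH(1)] deg_inf_Z[of 1] IH by auto
    moreover have "fls.vle (fls_const a) 0" by (simp add: fls.vle_def deg_inf_def)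
    ultimately show ?thesis using fls.v_add_dominated[of "Z * emb Z p" "fls_const a"] False
      by (auto simp: emb_pCons fls.vle_def add.commute)
  qed
qed simp

section \<open>Rational functions in \<open>f\<close>\<close>

context
  fixes f :: "'a::field_char_0 poly"
  assumes f: "degree f > 0"
begin

definition "xf = emb Z f"

lemma deg_inf_emb_xf: "p \<noteq> 0 \<Longrightarrow> emb xf p \<noteq> 0 \<and> deg_inf (emb xf p) = int (degree f) * int (degree p)"
proof -
  assume "p \<noteq> 0"
  then have "pcompose p f \<noteq> 0" using f by (simp add: pcompose_eq_0_iff)
  then show ?thesis using deg_inf_emb[of "pcompose p f"] unfolding xf_def emb_pcompose[symmetric]
    by (simp add: degree_pcompose)
qed

lemma emb_xf_inj: "emb xf p = emb xf q \<longleftrightarrow> p = q"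
  using deg_inf_emb_xf[of "p - q"] by (auto simp: emb_diff)

definition "Af = range (emb xf)"

definition "Kf = {emb xf p / emb xf q | p q. q \<noteq> 0}"

lemma Af_subring: "is_subring Af"
  unfolding Af_def by (rule is_subring_emb)

lemma const_Af: "fls_const a \<in> Af"
  unfolding Af_def by (simp flip: emb_const[of xf])

lemma xf_Af: "xf \<in> Af"
proof -
  have "emb xf [:0, 1:] = xf" by (simp add: emb_pCons)
  then show ?thesis unfolding Af_def by (intro image_eqI[of _ _ "[:0, 1:]"]) simp_all
qed

lemma Af_Kf: "Af \<subseteq> Kf"
proof
  fix a assume "a \<in> Af"
  then obtain p where "a = emb xf p / emb xf 1" unfolding Af_def by auto
  then show "a \<in> Kf" unfolding Kf_def using one_neq_zero by blast
qed

lemma Kf_subring: "is_subring Kf"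
  unfolding is_subring_def
proof (intro conjI ballI)
  show "1 \<in> Kf" using Af_Kf subring_closed(2)[OF Af_subring] by blast
  fix a b assume "a \<in> Kf" "b \<in> Kf"
  then obtain p q p' q' where pq: "a = emb xf p / emb xf q" "q \<noteq> 0" "b = emb xf p' / emb xf q'" "q' \<noteq> 0"
    unfolding Kf_def by blast
  have nz: "emb xf q \<noteq> 0" "emb xf q' \<noteq> 0" using pq deg_inf_emb_xf by auto
  have "a - b = emb xf (p * q' - p' * q) / emb xf (q * q')" "a * b = emb xf (p * p') / emb xf (q * q')"
    unfolding pq(1,3) using nz by (simp_all add: emb_diff emb_mult field_simps)
  moreover have "q * q' \<noteq> 0" using pq by simp
  ultimately show "a - b \<in> Kf" "a * b \<in> Kf" unfolding Kf_def by blast+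
qed

lemma Kf_inverse: "a \<in> Kf \<Longrightarrow> inverse a \<in> Kf"
proof -
  assume "a \<in> Kf"
  then obtain p q where pq: "a = emb xf p / emb xf q" "q \<noteq> 0" unfolding Kf_def by blast
  show ?thesis
  proof (cases "p = 0")
    case True
    then show ?thesis using pq subring_closed(1)[OF Kf_subring] by simp
  next
    case False
    then show ?thesis using pq unfolding Kf_def by auto
  qed
qed

lemma Kf_value: "a \<in> Kf \<Longrightarrow> a \<noteq> 0 \<Longrightarrow> int (degree f) dvd deg_inf a"
proof -
  assume "a \<in> Kf" "a \<noteq> 0"
  then obtain p q where pq: "a = emb xf p / emb xf q" "q \<noteq> 0" "p \<noteq> 0" unfolding Kf_def by force
  have "deg_inf a = deg_inf (emb xf p) - deg_inf (emb xf q)"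
    using fls.v_mult[of "emb xf p" "inverse (emb xf q)"] fls.v_inverse[of "emb xf q"] deg_inf_emb_xf pq
    by (simp add: divide_inverse)
  then show ?thesis using pq(2,3) deg_inf_emb_xf by simp
qed



text \<open>The subring \<open>S\<close> is a parameter because coordinates in \<open>k[f]\<close> give the integrality of \<open>g\<close> over \<open>k[f]\<close>, while
  coordinates in \<open>k(f)\<close> give the integrality of elements of value zero and feed the elimination.\<close>

definition z_span :: "'a fls set \<Rightarrow> 'a fls set" where
  "z_span S = {h. \<exists>a. (\<forall>i. a i \<in> S) \<and> h = (\<Sum>i<degree f. a i * Z ^ i)}"

context
  fixes S :: "'a fls set"
  assumes S: "is_subring S" and A_S: "Af \<subseteq> S"
begin

lemma z_span_add: "h \<in> z_span S \<Longrightarrow> k \<in> z_span S \<Longrightarrow> h + k \<in> z_span S"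
proof -
  assume "h \<in> z_span S" "k \<in> z_span S"
  then obtain a b where ab: "\<And>i. a i \<in> S" "h = (\<Sum>i<degree f. a i * Z ^ i)" "\<And>i. b i \<in> S" "k = (\<Sum>i<degree f. b i * Z ^ i)"
    unfolding z_span_def by blast
  then show ?thesis unfolding z_span_def using subring_closed(4)[OF S]
    by (intro CollectI exI[of _ "\<lambda>i. a i + b i"]) (simp add: sum.distrib distrib_right)
qed

lemma z_span_scale: "c \<in> S \<Longrightarrow> h \<in> z_span S \<Longrightarrow> c * h \<in> z_span S"
proof -
  assume "h \<in> z_span S" "c \<in> S"
  then obtain a where "\<And>i. a i \<in> S" "h = (\<Sum>i<degree f. a i * Z ^ i)"
    unfolding z_span_def by blast
  then show ?thesis unfolding z_span_def using subring_closed(6)[OF S \<open>c \<in> S\<close>]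
    by (intro CollectI exI[of _ "\<lambda>i. c * a i"]) (simp add: sum_distrib_left mult.assoc)
qed

lemma z_span_power_lt: "i < degree f \<Longrightarrow> Z ^ i \<in> z_span S"
  unfolding z_span_def using subring_closed(1,2)[OF S]
  by (intro CollectI exI[of _ "\<lambda>j. if j = i then 1 else 0"]) (simp add: if_distrib if_distribR cong: if_cong)

lemma z_span_0: "0 \<in> z_span S"
  unfolding z_span_def using subring_closed(1)[OF S] by (intro CollectI exI[of _ "\<lambda>j. 0"]) simp

lemma z_span_sum: "(\<And>i. i \<in> I \<Longrightarrow> h i \<in> z_span S) \<Longrightarrow> sum h I \<in> z_span S"
  by (induction I rule: infinite_finite_induct) (auto intro: z_span_add z_span_0)

lemma const_S: "fls_const a \<in> S"
  using const_Af A_S by blast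

text \<open>The equation \<open>f(z) = xf\<close> expresses the top power of \<open>z\<close> through lower ones; its leading coefficient is a unit.\<close>

lemma z_span_power_degree: "Z ^ degree f \<in> z_span S"
proof -
  let ?c = "fls_const (lead_coeff f)"
  have c: "?c \<noteq> 0" using f by auto
  have "xf = (\<Sum>i<degree f. fls_const (coeff f i) * Z ^ i) + ?c * Z ^ degree f"
    unfolding xf_def emb_altdef by (simp add: lessThan_Suc_atMost[symmetric])
  then have "Z ^ degree f = fls_const (inverse (lead_coeff f)) *
      (xf * Z ^ 0 + fls_const (-1) * (\<Sum>i<degree f. fls_const (coeff f i) * Z ^ i))"
    using c f by (simp add: mult.assoc[symmetric])
  moreover have "\<dots> \<in> z_span S"
    by (intro z_span_scale z_span_add z_span_sum z_span_power_lt const_S) (use f xf_Af A_S in auto)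
  ultimately show ?thesis by (simp only:)
qed

lemma z_span_Z: "h \<in> z_span S \<Longrightarrow> Z * h \<in> z_span S"
proof -
  assume "h \<in> z_span S"
  then obtain a where a: "\<And>i. a i \<in> S" "h = (\<Sum>i<degree f. a i * Z ^ i)"
    unfolding z_span_def by blast
  have "Z * h = (\<Sum>i<degree f. a i * Z ^ Suc i)" unfolding a(2) by (simp add: sum_distrib_left algebra_simps)
  moreover have "Z ^ Suc i \<in> z_span S" if "i < degree f" for i
    using z_span_power_lt[of "Suc i"] z_span_power_degree that by (cases "Suc i = degree f") auto
  ultimately show ?thesis using a(1) by (simp only:) (intro z_span_sum z_span_scale, auto)
qed

lemma z_span_Z_power: "h \<in> z_span S \<Longrightarrow> Z ^ i * h \<in> z_span S"
  by (induction i) (auto intro: z_span_Z simp: mult.assoc)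

lemma is_subring_z_span: "is_subring (z_span S)"
  unfolding is_subring_def
proof (intro conjI ballI)
  show "1 \<in> z_span S" using z_span_power_lt[OF f] by simp
  fix h k assume h: "h \<in> z_span S" and k: "k \<in> z_span S"
  have "h + fls_const (-1) * k \<in> z_span S" by (intro z_span_add z_span_scale h k const_S)
  then show "h - k \<in> z_span S" by simp
  obtain a where a: "\<And>i. a i \<in> S" "h = (\<Sum>i<degree f. a i * Z ^ i)"
    using h unfolding z_span_def by blast
  show "h * k \<in> z_span S" unfolding a(2) sum_distrib_right mult.assoc
    by (intro z_span_sum z_span_scale a(1) z_span_Z_power k)
qed

lemma S_z_span: "S \<subseteq> z_span S"
  using z_span_scale[OF _ z_span_power_lt[OF f]] by auto

lemma emb_Z_z_span: "emb Z p \<in> z_span S"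
proof (induction p)
  case (pCons a p)
  then show ?case unfolding emb_pCons using S_z_span const_S by (intro z_span_add z_span_Z) auto
qed (simp add: z_span_0)

lemma z_span_integral:
  assumes t: "t \<in> z_span S"
  obtains C where "over S C" "lead_coeff C = 1" "poly C t = 0"
proof -
  have "t * Z ^ i \<in> z_span S" if "i < degree f" for i
    using subring_closed(6)[OF is_subring_z_span t z_span_power_lt[OF that]] .
  then have "\<exists>a. \<forall>i. i < degree f \<longrightarrow> (\<forall>j. a i j \<in> S) \<and> t * Z ^ i = (\<Sum>j<degree f. a i j * Z ^ j)"
    unfolding z_span_def by (intro choice) blast
  then obtain a where "\<And>i j. i < degree f \<Longrightarrow> a i j \<in> S"
    "\<And>i. i < degree f \<Longrightarrow> t * Z ^ i = (\<Sum>j<degree f. a i j * Z ^ j)" by blast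
  then show thesis using integral_of_stable_span[OF S, of "degree f" a t "\<lambda>i. Z ^ i" 0] f that by auto
qed

end

text \<open>The values of the terms lie in different classes modulo the degree of \<open>f\<close>, so there is no cancellation.\<close>

lemma z_span_value:
  assumes a: "\<And>i. a i \<in> Kf" and nz: "(\<Sum>i<degree f. a i * Z ^ i) \<noteq> 0"
  shows "\<exists>i<degree f. a i \<noteq> 0 \<and> deg_inf (\<Sum>i<degree f. a i * Z ^ i) = deg_inf (a i) + int i \<and>
    (\<forall>j<degree f. a j \<noteq> 0 \<longrightarrow> deg_inf (a j) + int j \<le> deg_inf (a i) + int i)"
proof -
  have val: "deg_inf (a i * Z ^ i) = deg_inf (a i) + int i" if "a i \<noteq> 0" for i
    using fls.v_mult[OF that Z_nonzero] by (simp add: deg_inf_Z)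
  have "\<exists>i\<in>{..<degree f}. a i * Z ^ i \<noteq> 0"
    using nz by (meson sum.neutral)
  moreover have "i = j" if "i < degree f" "j < degree f" "a i \<noteq> 0" "a j \<noteq> 0"
    "deg_inf (a i * Z ^ i) = deg_inf (a j * Z ^ j)" for i j
  proof -
    have "int (degree f) dvd deg_inf (a j) - deg_inf (a i)" using Kf_value a that by (intro dvd_diff) auto
    moreover have "deg_inf (a j) - deg_inf (a i) = int i - int j" using that val by simp
    ultimately have "int i mod int (degree f) = int j mod int (degree f)" by (simp add: mod_eq_dvd_iff)
    then show ?thesis using that by simp
  qed
  ultimately have "\<exists>i\<in>{..<degree f}. a i * Z ^ i \<noteq> 0 \<and> deg_inf (\<Sum>i<degree f. a i * Z ^ i) = deg_inf (a i * Z ^ i) \<and>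
    (\<forall>j\<in>{..<degree f}. a j * Z ^ j \<noteq> 0 \<longrightarrow> deg_inf (a j * Z ^ j) \<le> deg_inf (a i * Z ^ i))"
    using fls.sum_distinct_values[of "{..<degree f}" "\<lambda>i. a i * Z ^ i"] by auto
  then show ?thesis using val by auto
qed

text \<open>In the basis of powers of \<open>Z\<close>, the entry \<open>a i j\<close> of the matrix of multiplication by \<open>t\<close> has value at
  most \<open>i - j\<close>, which is less than the degree of \<open>f\<close>. Being a multiple of that degree, the value is not
  positive, so the matrix has entries in the valuation ring of \<open>k(f)\<close> and the determinant trick applies.\<close>

lemma unit_integral:
  assumes t: "t \<in> z_span Kf" "t \<noteq> 0" "deg_inf t = 0"
  shows "\<exists>C. over Kf C \<and> (\<forall>i. fls.vle (coeff C i) 0) \<and> lead_coeff C = 1 \<and> poly C t = 0"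
proof -
  define V0 where "V0 = {a \<in> Kf. fls.vle a 0}"
  have V0: "is_subring V0"
    unfolding is_subring_def
  proof (intro conjI ballI)
    show "1 \<in> V0" using subring_closed(2)[OF Kf_subring] by (simp add: V0_def fls.vle_def fls.v_one)
    fix a b assume ab: "a \<in> V0" "b \<in> V0"
    then show "a - b \<in> V0" using fls.vle_add[of a 0 "- b"] fls.vle_minus[of b 0] subring_closed(3)[OF Kf_subring]
      by (simp add: V0_def)
    show "a * b \<in> V0" using ab fls.vle_mult[of a 0 b 0] subring_closed(6)[OF Kf_subring] by (simp add: V0_def)
  qed
  have "t * Z ^ i \<in> z_span Kf" if "i < degree f" for i
    using subring_closed(6)[OF is_subring_z_span[OF Kf_subring Af_Kf] t(1) z_span_power_lt[OF Kf_subring Af_Kf that]] .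
  then have "\<exists>a. \<forall>i. i < degree f \<longrightarrow> (\<forall>j. a i j \<in> Kf) \<and> t * Z ^ i = (\<Sum>j<degree f. a i j * Z ^ j)"
    unfolding z_span_def by (intro choice) blast
  then obtain a where a: "\<And>i j. i < degree f \<Longrightarrow> a i j \<in> Kf"
    "\<And>i. i < degree f \<Longrightarrow> t * Z ^ i = (\<Sum>j<degree f. a i j * Z ^ j)" by blast
  have "a i j \<in> V0" if ij: "i < degree f" "j < degree f" for i j
  proof (cases "a i j = 0")
    case False
    have "t * Z ^ i \<noteq> 0" "deg_inf (t * Z ^ i) = int i"
      using t fls.v_mult[OF t(2) Z_nonzero] by (auto simp: deg_inf_Z)
    then have "deg_inf (a i j) + int j \<le> int i"
      using z_span_value[of "a i"] a ij False by fastforce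
    then have lt: "deg_inf (a i j) < int (degree f)" using ij by linarith
    have "int (degree f) dvd deg_inf (a i j)" using Kf_value a(1)[OF ij(1)] False by blast
    then have "deg_inf (a i j) \<le> 0" using lt by (meson not_le zdvd_not_zless)
    then show ?thesis using a(1)[OF ij(1)] by (simp add: V0_def fls.vle_def)
  qed (simp add: subring_closed[OF V0])
  then obtain C where "over V0 C" "lead_coeff C = 1" "poly C t = 0"
    using integral_of_stable_span[OF V0, of "degree f" a t "\<lambda>i. Z ^ i" 0] a(2) f by auto
  then show ?thesis unfolding over_def V0_def by auto
qed

end

section \<open>A Gauss lemma for monic factors\<close>

lemma prime_divisor_poly_exists:
  fixes q :: "'a::field poly"
  assumes "degree q > 0"
  obtains p where "prime_elem p" "degree p > 0" "p dvd q"
proof -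
  define n where "n = (LEAST n. \<exists>p. p dvd q \<and> degree p = n \<and> n > 0)"
  have ex: "\<exists>n p. p dvd q \<and> degree p = n \<and> n > 0"
    by (intro exI[of _ "degree q"] exI[of _ q]) (simp add: assms)
  have "\<exists>p. p dvd q \<and> degree p = n \<and> n > 0"
    unfolding n_def by (rule LeastI_ex[OF ex])
  then obtain p where p: "p dvd q" "degree p = n" "n > 0" by blast
  have "irreducible p"
  proof (rule irreducibleI)
    show p0: "p \<noteq> 0" using p by auto
    show "\<not> is_unit p" using p p0 by (simp add: is_unit_iff_degree)
    fix a b assume ab: "p = a * b"
    then have nz: "a \<noteq> 0" "b \<noteq> 0" using p0 by auto
    have sum: "degree a + degree b = n" using ab nz p(2) by (simp add: degree_mult_eq)
    have "degree a = 0 \<or> degree a \<ge> n"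
      using Least_le[of "\<lambda>n. \<exists>p. p dvd q \<and> degree p = n \<and> n > 0" "degree a"] p(1) ab
      unfolding n_def by (metis dvd_mult_left not_gr_zero)
    then show "is_unit a \<or> is_unit b" using sum nz by (auto simp: is_unit_iff_degree)
  qed
  then show thesis using that field_poly_irreducible_imp_prime p by blast
qed

context
  fixes f :: "'a::field_char_0 poly"
  assumes f: "degree f > 0"
begin

definition lift_poly :: "'a poly poly \<Rightarrow> 'a fls poly" where
  "lift_poly p = map_poly (emb (xf f)) p"

lemma coeff_lift_poly: "coeff (lift_poly p) i = emb (xf f) (coeff p i)"
  by (simp add: lift_poly_def coeff_map_poly)

lemma lift_poly_mult: "lift_poly (p * q) = lift_poly p * lift_poly q"
  by (rule poly_eqI) (simp add: coeff_lift_poly coeff_mult emb_sum emb_mult)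

lemma lift_poly_const: "lift_poly [:c:] = [:emb (xf f) c:]"
  by (rule poly_eqI) (simp add: coeff_lift_poly coeff_pCons split: nat.splits)

lemma lift_poly_inj: "lift_poly p = lift_poly q \<Longrightarrow> p = q"
  by (rule poly_eqI) (metis coeff_lift_poly emb_xf_inj[OF f])

lemma over_Af_lift_poly: "over (Af f) h \<Longrightarrow> \<exists>p. h = lift_poly p"
proof -
  assume h: "over (Af f) h"
  then have "\<forall>i. \<exists>c. coeff h i = emb (xf f) c \<and> (coeff h i = 0 \<longrightarrow> c = 0)"
    unfolding over_def Af_def[OF f] by (metis emb_0 rangeE)
  then obtain c where c: "\<And>i. coeff h i = emb (xf f) (c i)" "\<And>i. coeff h i = 0 \<Longrightarrow> c i = 0" by metis
  have "coeff (\<Sum>i\<le>degree h. monom (c i) i) j = c j" for j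
    using c(2)[of j] by (simp add: coeff_sum coeff_eq_0 not_le)
  then show ?thesis using c(1) by (intro exI[of _ "\<Sum>i\<le>degree h. monom (c i) i"] poly_eqI) (simp add: coeff_lift_poly)
qed

definition denominator :: "'a fls poly \<Rightarrow> 'a poly \<Rightarrow> bool" where
  "denominator h q \<longleftrightarrow> q \<noteq> 0 \<and> (\<exists>p. [:emb (xf f) q:] * h = lift_poly p)"

lemma denominator_exists:
  assumes "over (Kf f) h"
  shows "\<exists>q. denominator h q"
  using assms
proof (induction h)
  case 0
  then show ?case by (intro exI[of _ 1]) (auto simp: denominator_def lift_poly_def intro: exI[of _ 0])
next
  case (pCons a h)
  then obtain q p where q: "q \<noteq> 0" "[:emb (xf f) q:] * h = lift_poly p"
    by (auto simp: over_pCons denominator_def)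
  obtain c e where ce: "a = emb (xf f) c / emb (xf f) e" "e \<noteq> 0"
    using pCons.prems unfolding over_pCons Kf_def[OF f] by blast
  have e: "emb (xf f) e \<noteq> 0" using deg_inf_emb_xf[OF f ce(2)] by blast
  have "[:emb (xf f) (q * e):] * pCons a h = pCons (emb (xf f) (q * c)) ([:emb (xf f) e:] * ([:emb (xf f) q:] * h))"
    using e by (simp add: ce(1) emb_mult mult_ac)
  also have "\<dots> = lift_poly (pCons (q * c) ([:e:] * p))"
    unfolding q(2) unfolding lift_poly_const[symmetric] lift_poly_mult[symmetric]
    by (rule poly_eqI) (simp add: coeff_lift_poly coeff_pCons split: nat.splits)
  finally show ?case using q(1) ce(2) unfolding denominator_def by (intro exI[of _ "q * e"]) auto
qed

text \<open>Take denominators \<open>q1\<close> and \<open>q2\<close> of \<open>P\<close> and \<open>B\<close> of least degree. A prime factor of \<open>q1\<close> divides the product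
  of the two cleared polynomials, hence one of them; as the factors are monic, it divides the corresponding
  denominator, which could then be made smaller. So \<open>q1\<close> is a constant.\<close>

lemma monic_factor_over_Af:
  assumes P: "over (Kf f) P" "lead_coeff P = 1" and B: "over (Kf f) B" "lead_coeff B = 1"
    and PB: "over (Af f) (P * B)"
  shows "over (Af f) P"
proof -
  let ?e = "emb (xf f)"
  have least: "\<exists>q p. q \<noteq> 0 \<and> [:?e q:] * h = lift_poly p \<and> (\<forall>q'. denominator h q' \<longrightarrow> degree q \<le> degree q')"
    if h: "over (Kf f) h" for h
  proof -
    obtain q0 where "denominator h q0" using denominator_exists[OF h] by blast
    then have ex: "\<exists>n q. denominator h q \<and> degree q = n" by (intro exI[of _ "degree q0"] exI[of _ q0]) simp
    define n where "n = (LEAST n. \<exists>q. denominator h q \<and> degree q = n)"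
    have "\<exists>q. denominator h q \<and> degree q = n"
      unfolding n_def by (rule LeastI_ex[OF ex])
    then obtain q where q: "denominator h q" "degree q = n" by blast
    have "degree q \<le> degree q'" if "denominator h q'" for q'
      unfolding q(2) n_def using that by (intro Least_le) blast
    then show ?thesis using q(1) unfolding denominator_def by blast
  qed
  obtain q1 p1 where 1: "q1 \<noteq> 0" "[:?e q1:] * P = lift_poly p1" "\<And>q. denominator P q \<Longrightarrow> degree q1 \<le> degree q"
    using least[OF P(1)] by blast
  obtain q2 p2 where 2: "q2 \<noteq> 0" "[:?e q2:] * B = lift_poly p2" "\<And>q. denominator B q \<Longrightarrow> degree q2 \<le> degree q"
    using least[OF B(1)] by blast
  obtain c where c: "P * B = lift_poly c" using over_Af_lift_poly[OF PB] by blast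
  have "lift_poly ([:q1 * q2:] * c) = lift_poly (p1 * p2)"
    unfolding lift_poly_mult lift_poly_const emb_mult c[symmetric] 1(2)[symmetric] 2(2)[symmetric] by (simp add: mult_ac)
  then have eq: "[:q1 * q2:] * c = p1 * p2" by (rule lift_poly_inj)
  \<comment> \<open>A prime \<open>p\<close> dividing the cleared polynomial \<open>s\<close> divides its coefficient \<open>q\<close>, and cancelling it leaves a smaller denominator.\<close>
  have reduce: False
    if p: "prime_elem p" "degree p > 0" "[:p:] dvd s" and h: "q \<noteq> 0" "[:?e q:] * h = lift_poly s" "lead_coeff h = 1"
      "\<And>q'. denominator h q' \<Longrightarrow> degree q \<le> degree q'" for p s q h
  proof -
    obtain s' where s': "s = [:p:] * s'" using p(3) by blast
    have "?e q = coeff (lift_poly s) (degree h)" using h(3) by (simp flip: h(2))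
    then have "q = p * coeff s' (degree h)"
      unfolding coeff_lift_poly s' by (simp add: emb_xf_inj[OF f])
    then obtain q' where q': "q = p * q'" by blast
    then have nz: "q' \<noteq> 0" "p \<noteq> 0" using h(1) by auto
    have ep: "?e p \<noteq> 0" using deg_inf_emb_xf[OF f nz(2)] by blast
    have "[:?e p:] * ([:?e q':] * h) = [:?e p:] * lift_poly s'"
      using h(2) unfolding s' q' lift_poly_mult lift_poly_const emb_mult by (simp add: mult_ac)
    moreover have "[:?e p:] \<noteq> 0" using ep by simp
    ultimately have "[:?e q':] * h = lift_poly s'" using mult_left_cancel by blast
    then have "denominator h q'" using nz unfolding denominator_def by blast
    from h(4)[OF this] show False using q' nz p(2) by (simp add: degree_mult_eq)
  qed
  have "degree q1 = 0"
  proof (rule ccontr)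
    assume "degree q1 \<noteq> 0"
    then obtain p where p: "prime_elem p" "degree p > 0" "p dvd q1" using prime_divisor_poly_exists[of q1] by auto
    have "[:p:] dvd p1 * p2" unfolding eq[symmetric] using p(3) by (simp add: const_poly_dvd_iff)
    then have "[:p:] dvd p1 \<or> [:p:] dvd p2" using lift_prime_elem_poly[OF p(1)] prime_elem_dvd_mult_iff by blast
    then show False using reduce[OF p(1,2) _ 1(1,2) P(2) 1(3)] reduce[OF p(1,2) _ 2(1,2) B(2) 2(3)] by blast
  qed
  then obtain u where u: "q1 = [:u:]" "u \<noteq> 0" using 1(1) by (auto elim!: degree_eq_zeroE)
  have "P = lift_poly ([:[:inverse u:]:] * p1)"
  proof -
    have "?e [:inverse u:] * ?e q1 = 1" using u by (simp flip: emb_mult add: one_pCons[symmetric])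
    then have "[:?e [:inverse u:]:] * ([:?e q1:] * P) = P" by (simp add: mult.commute)
    then show ?thesis unfolding lift_poly_mult lift_poly_const 1(2) by simp
  qed
  then show ?thesis by (auto simp: over_def coeff_lift_poly Af_def[OF f])
qed

end

section \<open>Plane polynomial curves\<close>

context
  fixes f g :: "'a::field_char_0 poly"
  assumes f: "degree f > 0"
begin

definition "yf = emb Z g"

interpretation C: ramified_element deg_inf "Kf f" "int (degree f)" yf
proof
  show "is_subring (Kf f)" by (rule Kf_subring[OF f])
  show "\<And>a. a \<in> Kf f \<Longrightarrow> inverse a \<in> Kf f" by (rule Kf_inverse[OF f])
  show "int (degree f) > 0" using f by simp
  show "\<And>a. a \<in> Kf f \<Longrightarrow> a \<noteq> 0 \<Longrightarrow> int (degree f) dvd deg_inf a" by (rule Kf_value[OF f])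
  show "\<exists>x\<in>Kf f. x \<noteq> 0 \<and> deg_inf x = int (degree f)"
  proof -
    have "f \<noteq> 0" using f by auto
    then show ?thesis using deg_inf_emb[of f] xf_Af[OF f] Af_Kf[OF f] unfolding xf_def[OF f]
      by (intro bexI[of _ "emb Z f"]) auto
  qed
qed

lemmas Kf_ring = Kf_subring[OF f] and Af_ring = Af_subring[OF f] and Af_sub_Kf = Af_Kf[OF f]

lemma poly_y_z_span: "over (Kf f) h \<Longrightarrow> poly h yf \<in> z_span f (Kf f)"
  using over_mono[OF _ S_z_span[OF f Kf_ring Af_sub_Kf]] poly_over_mem[OF is_subring_z_span[OF f Kf_ring Af_sub_Kf]]
    emb_Z_z_span[OF f Kf_ring Af_sub_Kf] unfolding yf_def by blast

lemma value_nonneg: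
  assumes "over (Af f) h" "poly h yf \<noteq> 0"
  shows "deg_inf (poly h yf) \<ge> 0"
proof -
  have "Af f \<subseteq> range (emb Z)" unfolding Af_def[OF f] xf_def[OF f] emb_pcompose[symmetric] by blast
  then have "poly h yf \<in> range (emb Z)"
    using over_mono[OF assms(1)] poly_over_mem[OF is_subring_emb] unfolding yf_def by blast
  then obtain p where p: "poly h yf = emb Z p" by blast
  then have "p \<noteq> 0" using assms(2) by auto
  then show ?thesis unfolding p using deg_inf_emb[of p] by simp
qed

text \<open>The minimal polynomial over \<open>k(f)\<close> divides any monic equation of \<open>g\<close> over \<open>k[f]\<close>, hence is itself
  defined over \<open>k[f]\<close>.\<close>

lemma minimal_polynomial:
  obtains P where "over (Af f) P" "lead_coeff P = 1" "poly P yf = 0"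
    "\<And>h. over (Kf f) h \<Longrightarrow> h \<noteq> 0 \<Longrightarrow> degree h < degree P \<Longrightarrow> poly h yf \<noteq> 0"
proof -
  have "yf \<in> z_span f (Af f)" unfolding yf_def by (rule emb_Z_z_span[OF f Af_ring subset_refl])
  then obtain C where C: "over (Af f) C" "lead_coeff C = 1" "poly C yf = 0"
    using z_span_integral[OF f Af_ring subset_refl] by blast
  let ?Q = "\<lambda>n. \<exists>h. over (Kf f) h \<and> h \<noteq> 0 \<and> poly h yf = 0 \<and> degree h = n"
  define n where "n = (LEAST n. ?Q n)"
  have CK: "over (Kf f) C" by (rule over_mono[OF C(1) Af_sub_Kf])
  then have "?Q (degree C)" using C by (intro exI[of _ C]) auto
  then have "?Q n" unfolding n_def by (rule LeastI)
  then obtain h where h: "over (Kf f) h" "h \<noteq> 0" "poly h yf = 0" "degree h = n" by blast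
  have min: "poly q yf \<noteq> 0" if "over (Kf f) q" "q \<noteq> 0" "degree q < n" for q
    using not_less_Least[of "degree q" ?Q] that unfolding n_def by blast
  define P where "P = [:inverse (lead_coeff h):] * h"
  have i: "inverse (lead_coeff h) \<in> Kf f" "inverse (lead_coeff h) \<noteq> 0"
    using h Kf_inverse[OF f] by (auto simp: over_def)
  have P: "over (Kf f) P" "lead_coeff P = 1" "poly P yf = 0" "degree P = n"
  proof -
    show "over (Kf f) P" unfolding P_def using h(1) i(1)
      by (intro over_closed(6)[OF Kf_ring]) (auto simp: over_pCons over_closed[OF Kf_ring])
    show "lead_coeff P = 1" "degree P = n" "poly P yf = 0" using h i(2) by (auto simp: P_def)
  qed
  have P0: "P \<noteq> 0" using P(2) by auto
  note divmod_over = over_divmod[OF Kf_ring P(1,2) CK]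
  have "C mod P = 0"
  proof (rule ccontr)
    assume 0: "C mod P \<noteq> 0"
    then have "degree (C mod P) < n" using degree_mod_less[OF P0, of C] P(4) by auto
    moreover have "poly (C mod P) yf = 0"
      using C(3) P(3) by (metis div_mult_mod_eq poly_add poly_mult mult_zero_right add_0)
    ultimately show False using min[of "C mod P"] divmod_over 0 by blast
  qed
  then have PB: "C = P * (C div P)" by (metis add.right_neutral mult.commute div_mult_mod_eq)
  have "lead_coeff (P * (C div P)) = 1" using PB C(2) by simp
  then have "lead_coeff (C div P) = 1" unfolding lead_coeff_mult P(2) by simp
  moreover have "over (Af f) (P * (C div P))" using PB C(1) by simp
  ultimately have "over (Af f) P" using monic_factor_over_Af[OF f P(1,2)] divmod_over by blast
  then show thesis using that P min by blast
qed

text \<open>Row \<open>s\<close> of an echelon form: \<open>a s\<close> are the coordinates of \<open>H s\<close> at \<open>y\<close>, and the pivot \<open>p s\<close> is the coordinate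
  that determines the value. Rows vanish at all earlier pivots, so the pivots are distinct.\<close>

definition reduced :: "(nat \<Rightarrow> 'a fls poly) \<Rightarrow> (nat \<Rightarrow> nat \<Rightarrow> 'a fls) \<Rightarrow> (nat \<Rightarrow> nat) \<Rightarrow> nat \<Rightarrow> bool" where
  "reduced H a p s \<longleftrightarrow> over (Kf f) (H s) \<and> lead_coeff (H s) = 1 \<and> degree (H s) = s \<and>
    (\<forall>i. a s i \<in> Kf f) \<and> poly (H s) yf = (\<Sum>i<degree f. a s i * Z ^ i) \<and> p s < degree f \<and> a s (p s) \<noteq> 0 \<and>
    int (degree f) dvd deg_inf (poly (H s) yf) - int (p s) \<and> (\<forall>t<s. a s (p t) = 0)"

text \<open>Subtracting multiples of the earlier rows from the row of \<open>y ^ r\<close> clears the earlier pivots one by one. By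
  linear independence the result is not zero, and the coordinate that determines its value is the new
  pivot.\<close>

lemma elimination:
  fixes N :: nat
  assumes indep: "\<And>h. over (Kf f) h \<Longrightarrow> h \<noteq> 0 \<Longrightarrow> degree h < N \<Longrightarrow> poly h yf \<noteq> 0"
  shows "r \<le> N \<Longrightarrow> \<exists>H a p. \<forall>s<r. reduced H a p s"
proof (induction r)
  case (Suc r)
  then obtain H a p where IH: "\<And>s. s < r \<Longrightarrow> reduced H a p s"
    using Suc_leD by blast
  have "\<exists>h b. over (Kf f) h \<and> lead_coeff h = 1 \<and> degree h = r \<and> (\<forall>i. b i \<in> Kf f) \<and>
    poly h yf = (\<Sum>i<degree f. b i * Z ^ i) \<and> (\<forall>s<t. b (p s) = 0)" if "t \<le> r" for t
    using that
  proof (induction t)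
    case 0
    have m: "over (Kf f) (monom 1 r)" by (intro over_monom[OF Kf_ring] subring_closed(2)[OF Kf_ring])
    then obtain b where "\<forall>i. b i \<in> Kf f" "poly (monom 1 r) yf = (\<Sum>i<degree f. b i * Z ^ i)"
      using poly_y_z_span[of "monom 1 r"] unfolding z_span_def[OF f] by blast
    then show ?case using m by (intro exI[of _ "monom 1 r"] exI[of _ b]) (auto simp: degree_monom_eq)
  next
    case (Suc t)
    then obtain h b where hb: "over (Kf f) h" "lead_coeff h = 1" "degree h = r" "\<And>i. b i \<in> Kf f"
      "poly h yf = (\<Sum>i<degree f. b i * Z ^ i)" "\<And>s. s < t \<Longrightarrow> b (p s) = 0"
      using Suc_leD by blast
    have t: "t < r" using Suc.prems by simp
    note Ht = IH[OF t, unfolded reduced_def]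
    define c where "c = b (p t) * inverse (a t (p t))"
    have c: "c \<in> Kf f" unfolding c_def using Ht hb(4) Kf_inverse[OF f] by (intro subring_closed(6)[OF Kf_ring]) auto
    have lt: "degree ([:c:] * H t) < r" using Ht t by (auto intro: le_less_trans[OF degree_smult_le])
    have "degree (h - [:c:] * H t) = r"
      using degree_add_eq_left[of "- ([:c:] * H t)" h] lt hb(3) by simp
    moreover have "coeff (h - [:c:] * H t) r = 1"
      unfolding coeff_diff using coeff_eq_0[OF lt] hb(2,3) by simp
    moreover have "over (Kf f) (h - [:c:] * H t)" using hb(1) Ht c
      by (intro over_closed(3,6)[OF Kf_ring]) (auto simp: over_pCons over_closed[OF Kf_ring])
    moreover have "b i - c * a t i \<in> Kf f" for i
      using hb(4) Ht c by (intro subring_closed(3,6)[OF Kf_ring]) auto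
    moreover have "poly (h - [:c:] * H t) yf = (\<Sum>i<degree f. (b i - c * a t i) * Z ^ i)"
      using hb(5) Ht by (simp add: left_diff_distrib sum_subtractf sum_distrib_left mult.assoc)
    moreover have "b (p s) - c * a t (p s) = 0" if "s < Suc t" for s
      using that hb(6)[of s] Ht by (cases "s = t") (auto simp: c_def)
    ultimately show ?case by (intro exI[of _ "h - [:c:] * H t"] exI[of _ "\<lambda>i. b i - c * a t i"]) auto
  qed
  from this[of r] obtain h b where hb: "over (Kf f) h" "lead_coeff h = 1" "degree h = r" "\<And>i. b i \<in> Kf f"
      "poly h yf = (\<Sum>i<degree f. b i * Z ^ i)" "\<And>s. s < r \<Longrightarrow> b (p s) = 0"
    by auto
  have "poly h yf \<noteq> 0" using indep[OF hb(1)] hb(2,3) Suc.prems by force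
  then obtain i where i: "i < degree f" "b i \<noteq> 0" "deg_inf (poly h yf) = deg_inf (b i) + int i"
    using z_span_value[OF f, of b, OF hb(4)] unfolding hb(5) by blast
  then have i_dvd: "int (degree f) dvd deg_inf (poly h yf) - int i" using Kf_value[OF f hb(4)] by simp
  have "reduced (H(r := h)) (a(r := b)) (p(r := i)) s" if "s < Suc r" for s
  proof (cases "s = r")
    case True
    then show ?thesis unfolding reduced_def using hb(1-4,6) i(1,2) i_dvd by (simp add: hb(5)[symmetric])
  next
    case False
    then have "reduced (H(r := h)) (a(r := b)) (p(r := i)) s = reduced H a p s"
      using that by (simp add: reduced_def)
    then show ?thesis using IH[of s] that False by simp
  qed
  then show ?case by blast
qed simp

text \<open>The values of the rows are congruent to their pivots, which are distinct.\<close>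

lemma opt_exists:
  fixes N :: nat
  assumes indep: "\<And>h. over (Kf f) h \<Longrightarrow> h \<noteq> 0 \<Longrightarrow> degree h < N \<Longrightarrow> poly h yf \<noteq> 0"
    and r: "r < N"
  shows "\<exists>h. C.opt r h"
proof -
  obtain H a p where H: "\<And>s. s < N \<Longrightarrow> reduced H a p s"
    using elimination[OF indep order_refl] by blast
  have "C.opt s (H s)" if "s < N" for s
    using that
  proof (induction s rule: less_induct)
    case (less s)
    note Hs = H[OF less.prems, unfolded reduced_def]
    have "\<not> int (degree f) dvd deg_inf (poly (H s) yf) - deg_inf (poly q yf)"
      if q: "over (Kf f) q" "q \<noteq> 0" "degree q < s" for q
    proof
      assume dvd: "int (degree f) dvd deg_inf (poly (H s) yf) - deg_inf (poly q yf)"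
      have "\<exists>t\<le>degree q. \<exists>c\<in>Kf f. c \<noteq> 0 \<and> deg_inf (poly q yf) = deg_inf c + deg_inf (poly (H t) yf)"
        using C.value_via_basis[OF Kf_ring subset_refl _ q, of H] less H[unfolded reduced_def] by simp
      then obtain t c where t: "t < s" "c \<in> Kf f" "c \<noteq> 0" "deg_inf (poly q yf) = deg_inf c + deg_inf (poly (H t) yf)"
        using q(3) by (meson le_less_trans)
      note Ht = H[OF less_trans[OF t(1) less.prems], unfolded reduced_def]
      have 1: "int (degree f) dvd deg_inf (poly (H s) yf) - int (p s)" using Hs by blast
      have 2: "int (degree f) dvd deg_inf (poly (H t) yf) - int (p t)" using Ht by blast
      have 3: "int (degree f) dvd deg_inf c" using Kf_value[OF f t(2,3)] .
      have "int (p s) - int (p t) = (deg_inf (poly (H s) yf) - deg_inf (poly q yf)) + deg_inf c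
        - (deg_inf (poly (H s) yf) - int (p s)) + (deg_inf (poly (H t) yf) - int (p t))"
        using t(4) by simp
      then have "int (degree f) dvd int (p s) - int (p t)"
        using dvd 1 2 3 by (metis dvd_add dvd_diff)
      then have "int (p s) mod int (degree f) = int (p t) mod int (degree f)" by (simp add: mod_eq_dvd_iff)
      then have "p s = p t" using Hs Ht by simp
      then show False using Hs t(1) by auto
    qed
    moreover have "poly (H s) yf \<noteq> 0" using indep[of "H s"] Hs less.prems by force
    ultimately show ?case unfolding C.opt_def using Hs by blast
  qed
  then show ?thesis using r by blast
qed

lemma curve_instance:
  obtains P where "polynomial_curve deg_inf (Kf f) (int (degree f)) yf P (Af f)"
proof -
  obtain P where P: "over (Af f) P" "lead_coeff P = 1" "poly P yf = 0"
    "\<And>h. over (Kf f) h \<Longrightarrow> h \<noteq> 0 \<Longrightarrow> degree h < degree P \<Longrightarrow> poly h yf \<noteq> 0"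
    using minimal_polynomial by blast
  have "polynomial_curve deg_inf (Kf f) (int (degree f)) yf P (Af f)"
  proof unfold_locales
    show "over (Kf f) P" by (rule over_mono[OF P(1) Af_sub_Kf])
    show "\<And>r. r < degree P \<Longrightarrow> \<exists>h. C.opt r h" using opt_exists[OF P(4)] by blast
    show "\<exists>C. over (Kf f) C \<and> (\<forall>i. fls.vle (coeff C i) 0) \<and> lead_coeff C = 1 \<and> poly C (poly h yf) = 0"
      if "over (Kf f) h" "poly h yf \<noteq> 0" "deg_inf (poly h yf) = 0" for h
      using unit_integral[OF f poly_y_z_span[OF that(1)] that(2,3)] .
    show "\<exists>a\<in>Af f. a * of_nat D = 1" if "D > 0" for D
    proof (intro bexI)
      show "fls_const (inverse (of_nat D)) * of_nat D = (1 :: 'a fls)"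
        using that by (simp add: fls_of_nat)
    qed (rule const_Af[OF f])
  qed (use P Af_ring Af_sub_Kf value_nonneg in auto)
  then show thesis by (rule that)
qed

lemma subalgebra_gen_as_polynomials:
  assumes "u \<in> subalgebra_gen {f, g}"
  shows "\<exists>U. over (Af f) U \<and> poly U yf = emb Z u"
proof -
  let ?T = "{u. \<exists>U. over (Af f) U \<and> poly U yf = emb Z u}"
  have "is_subalgebra ?T"
    unfolding is_subalgebra_def
  proof (intro conjI ballI allI)
    show "1 \<in> ?T" by (auto intro!: exI[of _ 1] over_closed[OF Af_ring])
    fix p q assume "p \<in> ?T" "q \<in> ?T"
    then obtain U V where "over (Af f) U" "poly U yf = emb Z p" "over (Af f) V" "poly V yf = emb Z q" by blast
    then show "p + q \<in> ?T" "p * q \<in> ?T"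
      using over_closed(4,6)[OF Af_ring, of U V] by (auto simp: emb_add emb_mult intro: exI[of _ "U + V"] exI[of _ "U * V"])
  next
    fix a p assume "p \<in> ?T"
    then obtain U where U: "over (Af f) U" "poly U yf = emb Z p" by blast
    have "over (Af f) ([:fls_const a:] * U)"
      using U(1) const_Af[OF f] by (intro over_closed(6)[OF Af_ring]) (auto simp: over_pCons over_closed[OF Af_ring])
    then show "Polynomial.smult a p \<in> ?T" using U(2)
      by (auto simp: emb_smult intro!: exI[of _ "[:fls_const a:] * U"])
  qed
  moreover have "{f, g} \<subseteq> ?T"
  proof -
    have "over (Af f) [:emb Z f:] \<and> over (Af f) [:0, 1:]"
      using xf_Af[OF f] unfolding xf_def[OF f] by (auto simp: over_pCons over_closed[OF Af_ring] subring_closed[OF Af_ring])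
    then show ?thesis by (auto simp: yf_def intro: exI[of _ "[:emb Z f:]"] exI[of _ "[:0, 1:]"])
  qed
  ultimately show ?thesis using assms hull_minimal[of "{f, g}" ?T is_subalgebra] unfolding subalgebra_gen_def by blast
qed

lemma no_shifted_degrees:
  assumes g: "degree g < degree f" "\<not> degree g dvd degree f"
    and c: "c > 0" "c \<le> degree g"
    and u: "u \<in> subalgebra_gen {f, g}" "u \<noteq> 0" "degree u = degree f - c"
    and w: "w \<in> subalgebra_gen {f, g}" "w \<noteq> 0" "degree w = degree g - c"
  shows False
proof -
  obtain P where "polynomial_curve deg_inf (Kf f) (int (degree f)) yf P (Af f)" using curve_instance by blast
  then interpret curve: polynomial_curve deg_inf "Kf f" "int (degree f)" yf P "Af f" .
  obtain U W where UW: "over (Af f) U" "poly U yf = emb Z u" "over (Af f) W" "poly W yf = emb Z w"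
    using subalgebra_gen_as_polynomials u(1) w(1) by metis
  have g0: "g \<noteq> 0" using c by auto
  have y: "yf \<noteq> 0" "deg_inf yf = int (degree g)" unfolding yf_def using deg_inf_emb[OF g0] by auto
  show False
  proof (rule curve.no_common_shift[OF y(1) _ UW(1) _ UW(3)])
    show "\<not> int (degree f) dvd deg_inf yf" using y(2) g(1) c by (auto dest: dvd_imp_le)
    show "poly U yf \<noteq> 0" "poly W yf \<noteq> 0" using UW deg_inf_emb u(2) w(2) by auto
    show "deg_inf (poly U yf) = int (degree f) - int c" using UW(2) deg_inf_emb[OF u(2)] u(3) g(1) c by simp
    show "deg_inf (poly W yf) = deg_inf yf - int c" using UW(4) deg_inf_emb[OF w(2)] w(3) c y(2) by simp
  qed (use y(2) g c in auto)
qed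

end

theorem theorem3p1:
  fixes f g :: "'a::field_char_0 poly" and m n c :: nat
  assumes "m = degree f" and "n = degree g"
    and "c > 0" and "c \<le> min m n"
    and "\<exists>u v. u \<in> subalgebra_gen {f, g} \<and> v \<in> subalgebra_gen {f, g} \<and>
           u \<noteq> 0 \<and> v \<noteq> 0 \<and> degree u = m - c \<and> degree v = n - c"
  shows "m dvd n \<or> n dvd m"
proof (rule ccontr)
  assume ndvd: "\<not> (m dvd n \<or> n dvd m)"
  obtain u v where uv: "u \<in> subalgebra_gen {f, g}" "v \<in> subalgebra_gen {f, g}" "u \<noteq> 0" "v \<noteq> 0"
    "degree u = m - c" "degree v = n - c" using assms(5) by blast
  have "m \<noteq> n" using ndvd by auto
  then consider "n < m" | "m < n" by linarith
  then show False
  proof cases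
    case 1
    show ?thesis
      by (rule no_shifted_degrees[of f g c u v]) (use 1 assms ndvd uv in auto)
  next
    case 2
    have swap: "{f, g} = {g, f}" by blast
    show ?thesis
      by (rule no_shifted_degrees[of g f c v u]) (use 2 assms ndvd uv in \<open>auto simp: swap\<close>)
  qed
qed

end
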